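(* Let $g, r, d$ be integers with $g\ge 0$ and $r\ge 0$, and let $\Gamma$ be a chain of $g$ loops with generic edge lengths. If $\rho=g-(r+1)(g-d+r)$ is zero, then there are exactly $$\lambda = g!\prod_{i=0}^{r}\frac{i!}{(g-d+r+i)!}$$ distinct divisor classes of degree $d$ and rank $r$ on $\Gamma$.
   Context: Chain of loops: for $g\ge 0$ and positive reals $\ell_1,\dots,\ell_g,m_1,\dots,m_g$, the chain of $g$ loops $\Gamma$ is the compact connected metric graph with points $v_0,\dots,v_g$ in which, for each $1\le i\le g$, exactly two edges join $v_{i-1}$ to $v_i$: a top edge of length $\ell_i$ and a bottom edge of length $m_i$ (together forming the $i$th loop); there are no other edges (for $g=0$, $\Gamma$ is the single point $v_0$). The edge lengths are generic if none of the ratios $\ell_i/m_i$ is equal to the ratio of two positive integers whose sum is less than or equal to $2g-2$. Divisors on a metric graph $\Gamma$: $\operatorname{Div}(\Gamma)$ is the free abelian group on the points of $\Gamma$; the degree of a divisor is the sum of its coefficients; a divisor is effective if all its coefficients are nonnegative. For a continuous function $\psi$ on $\Gamma$ that is linear with integer slope on each edge of some finite subdivision of $\Gamma$, $\operatorname{div}(\psi)=\sum_v \operatorname{ord}_v(\psi)\,v$, where $\operatorname{ord}_v(\psi)$ is the sum of the incoming slopes of $\psi$ at $v$ along the edges containing $v$. Two divisors are equivalent, $D\sim D'$, if $D-D'=\operatorname{div}(\psi)$ for some such $\psi$; a divisor class is an equivalence class for $\sim$. Rank: $r(D)=-1$ if $D$ is not equivalent to an effective divisor; otherwise $r(D)$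 is the largest nonnegative integer $r$ such that $D-E$ is equivalent to an effective divisor for every effective divisor $E$ of degree $r$ on $\Gamma$. Degree and rank depend only on the divisor class. *)

theory Defs
  imports "HOL-Analysis.Analysis" "HOL-Algebra.Free_Abelian_Groups"
begin

section \<open>Metric graphs\<close>

text \<open>
  A metric graph is given by a combinatorial model: an edge \<open>e\<close> is a copy of the interval
  \<open>[0, len e]\<close>, with \<open>0\<close> glued to the vertex \<open>tail e\<close> and \<open>len e\<close> glued to the
  vertex \<open>head e\<close>.  The orientation only serves to parametrize the edge.
\<close>

record ('v, 'e) metric_graph =
  verts :: "'v set"
  edges :: "'e set"
  tail :: "'e \<Rightarrow> 'v"
  head :: "'e \<Rightarrow> 'v"
  len :: "'e \<Rightarrow> real"

datatype ('v, 'e) point = Vertex 'v | Inner 'e real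

definition points :: "('v, 'e) metric_graph \<Rightarrow> ('v, 'e) point set" where
  "points G = Vertex ` verts G \<union> {Inner e t | e t. e \<in> edges G \<and> 0 < t \<and> t < len G e}"

definition edge_param :: "('v, 'e) metric_graph \<Rightarrow> 'e \<Rightarrow> real \<Rightarrow> ('v, 'e) point" where
  "edge_param G e t =
     (if t = 0 then Vertex (tail G e)
      else if t = len G e then Vertex (head G e)
      else Inner e t)"


section \<open>Divisors\<close>

abbreviation Div :: "('v, 'e) metric_graph \<Rightarrow> (('v, 'e) point \<Rightarrow>\<^sub>0 int) set" where
  "Div G \<equiv> carrier (free_Abelian_group (points G))"

definition div_degree :: "('a \<Rightarrow>\<^sub>0 int) \<Rightarrow> int" where
  "div_degree D = (\<Sum>p\<in>Poly_Mapping.keys D. Poly_Mapping.lookup D p)"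

definition effective :: "('a \<Rightarrow>\<^sub>0 int) \<Rightarrow> bool" where
  "effective D \<longleftrightarrow> (\<forall>p. 0 \<le> Poly_Mapping.lookup D p)"


section \<open>Piecewise linear functions\<close>

definition linear_int_slope_on :: "real \<Rightarrow> real \<Rightarrow> (real \<Rightarrow> real) \<Rightarrow> bool" where
  "linear_int_slope_on a b f \<longleftrightarrow> (\<exists>k::int. \<forall>t\<in>{a..b}. f t = f a + of_int k * (t - a))"

text \<open>
  \<open>S\<close> is the set of interior subdivision points of \<open>[0, L]\<close>: every subinterval with no
  point of \<open>S\<close> in its interior lies in a single edge of the subdivision.
\<close>

definition piecewise_linear_int :: "real \<Rightarrow> (real \<Rightarrow> real) \<Rightarrow> bool" where
  "piecewise_linear_int L f \<longleftrightarrow>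
     (\<exists>S. finite S \<and>
        (\<forall>a b. 0 \<le> a \<and> a \<le> b \<and> b \<le> L \<and> {a<..<b} \<inter> S = {} \<longrightarrow> linear_int_slope_on a b f))"

text \<open>
  In the topology of the metric graph (the quotient of the disjoint union of the vertices and
  the closed edges), a function is continuous if and only if its pullback to every closed
  edge is; compatibility at the vertices is automatic because \<open>\<psi>\<close> is a function on points.
\<close>

definition PL :: "('v, 'e) metric_graph \<Rightarrow> (('v, 'e) point \<Rightarrow> real) set" where
  "PL G = {\<psi>. \<forall>e\<in>edges G.
     continuous_on {0..len G e} (\<lambda>t. \<psi> (edge_param G e t)) \<and>
     piecewise_linear_int (len G e) (\<lambda>t. \<psi> (edge_param G e t))}"

definition left_slope :: "(real \<Rightarrow> real) \<Rightarrow> real \<Rightarrow> int" where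
  "left_slope f t = (THE k::int. \<forall>\<^sub>F s in at_left t. f s = f t + of_int k * (s - t))"

definition right_slope :: "(real \<Rightarrow> real) \<Rightarrow> real \<Rightarrow> int" where
  "right_slope f t = (THE k::int. \<forall>\<^sub>F s in at_right t. f s = f t + of_int k * (s - t))"

text \<open>
  The slope coming into \<open>t\<close> from below is the left slope; the one coming in from above is the
  negative of the right slope.
\<close>

fun ord_at :: "('v, 'e) metric_graph \<Rightarrow> (('v, 'e) point \<Rightarrow> real) \<Rightarrow> ('v, 'e) point \<Rightarrow> int" where
  "ord_at G \<psi> (Vertex v) =
     (\<Sum>e\<in>{e\<in>edges G. head G e = v}. left_slope (\<lambda>t. \<psi> (edge_param G e t)) (len G e)) -
     (\<Sum>e\<in>{e\<in>edges G. tail G e = v}. right_slope (\<lambda>t. \<psi> (edge_param G e t)) 0)"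
| "ord_at G \<psi> (Inner e t) =
     left_slope (\<lambda>s. \<psi> (edge_param G e s)) t - right_slope (\<lambda>s. \<psi> (edge_param G e s)) t"

definition div_of :: "('v, 'e) metric_graph \<Rightarrow> (('v, 'e) point \<Rightarrow> real) \<Rightarrow> ('v, 'e) point \<Rightarrow>\<^sub>0 int" where
  "div_of G \<psi> = (\<Sum>p\<in>{p\<in>points G. ord_at G \<psi> p \<noteq> 0}. frag_cmul (ord_at G \<psi> p) (frag_of p))"


section \<open>Linear equivalence and rank\<close>

definition equivalent ::
  "('v, 'e) metric_graph \<Rightarrow> (('v, 'e) point \<Rightarrow>\<^sub>0 int) \<Rightarrow> (('v, 'e) point \<Rightarrow>\<^sub>0 int) \<Rightarrow> bool" where
  "equivalent G D D' \<longleftrightarrow> (\<exists>\<psi>\<in>PL G. D - D' = div_of G \<psi>)"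

definition divisor_classes :: "('v, 'e) metric_graph \<Rightarrow> (('v, 'e) point \<Rightarrow>\<^sub>0 int) set set" where
  "divisor_classes G = Div G // {(D, D'). D \<in> Div G \<and> D' \<in> Div G \<and> equivalent G D D'}"

definition equiv_to_effective :: "('v, 'e) metric_graph \<Rightarrow> (('v, 'e) point \<Rightarrow>\<^sub>0 int) \<Rightarrow> bool" where
  "equiv_to_effective G D \<longleftrightarrow> (\<exists>D'\<in>Div G. effective D' \<and> equivalent G D D')"

definition rank_of :: "('v, 'e) metric_graph \<Rightarrow> (('v, 'e) point \<Rightarrow>\<^sub>0 int) \<Rightarrow> int" where
  "rank_of G D =
     (if \<not> equiv_to_effective G D then -1
      else int (GREATEST r::nat. \<forall>E\<in>Div G. effective E \<and> div_degree E = int r \<longrightarrow>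
                  equiv_to_effective G (D - E)))"


section \<open>The chain of loops\<close>

datatype side = Top | Bottom

definition chain_of_loops ::
  "nat \<Rightarrow> (nat \<Rightarrow> real) \<Rightarrow> (nat \<Rightarrow> real) \<Rightarrow> (nat, nat \<times> side) metric_graph" where
  "chain_of_loops g l m =
     \<lparr> verts = {0..g},
       edges = {1..g} \<times> UNIV,
       tail = (\<lambda>(i, s). i - 1),
       head = (\<lambda>(i, s). i),
       len = (\<lambda>(i, s). case s of Top \<Rightarrow> l i | Bottom \<Rightarrow> m i) \<rparr>"

definition generic_lengths :: "nat \<Rightarrow> (nat \<Rightarrow> real) \<Rightarrow> (nat \<Rightarrow> real) \<Rightarrow> bool" where
  "generic_lengths g l m \<longleftrightarrow>
     (\<forall>i\<in>{1..g}. \<not> (\<exists>p q :: int. 0 < p \<and> 0 < q \<and> p + q \<le> 2 * int g - 2 \<and>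
                        l i / m i = of_int p / of_int q))"

end

theory Submission
  imports Defs "HOL-Library.Real_Mod"
begin

text \<open>
  Retracting the chain to its \<open>i\<close>th loop and adding up positions gives, for every divisor, a
  coordinate in the circle of circumference \<open>l i + m i\<close>.  Summation by parts on the edges, and an
  explicit piecewise linear function for the converse, show that two divisors are equivalent if and
  only if they have the same degree and the same \<open>g\<close> coordinates.

  In these coordinates a greedy procedure that walks along the chain computes the least degree of
  an effective divisor with given coordinates.  Subtracting the worst effective divisor of degree
  \<open>r\<close> from a class turns this into a dynamic programme whose state is a strictly increasing
  sequence \<open>h 0 < \<dots> < h r\<close>.  At the \<open>i\<close>th loop every entry grows by one, except that \<open>h j\<close> stays
  if the \<open>i\<close>th coordinate equals \<open>h j \<cdot> l i\<close> and \<open>h (j - 1) + 1 < h j\<close>; by genericity at most one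
  entry stays.  Recording the stays as boxes of a Young diagram, rank at least \<open>r\<close> means that the
  diagram at the end contains the rectangle with \<open>r + 1\<close> rows and \<open>g - d + r\<close> columns.  If
  \<open>\<rho> = 0\<close>, this rectangle has \<open>g\<close> boxes, so a box is added at every loop; the order in which this
  happens is a standard Young tableau and determines all coordinates.  The tableaux are counted by
  Frobenius' form of the hook length formula.
\<close>

section \<open>Counting ballot words\<close>

text \<open>The factor that the product of all differences of the \<open>y i\<close> acquires when
  \<open>y j\<close> is lowered by one; see \<open>vandermonde_prod_shift\<close>.\<close>

definition shift_ratio :: "nat \<Rightarrow> (nat \<Rightarrow> real) \<Rightarrow> nat \<Rightarrow> real" where
  "shift_ratio k y j = (\<Prod>i\<in>{..<k} - {j}. 1 - 1 / (y j - y i))"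

lemma shift_ratio_Suc:
  assumes "j < k"
  shows "shift_ratio (Suc k) y j = shift_ratio k y j * (1 - 1 / (y j - y k))"
proof -
  have "{..<Suc k} - {j} = insert k ({..<k} - {j})" using assms by auto
  then show ?thesis by (simp add: shift_ratio_def)
qed

lemma shift_ratio_Suc_last: "shift_ratio (Suc k) y k = (\<Prod>i<k. 1 - 1 / (y k - y i))"
proof -
  have "{..<Suc k} - {k} = {..<k}" by auto
  then show ?thesis by (simp add: shift_ratio_def)
qed

lemma inj_on_lessThan_Suc_neq:
  assumes "inj_on y {..<Suc k}" "i < k"
  shows "y i \<noteq> y k"
  using assms by (auto simp: inj_on_def)

text \<open>Partial fractions in \<open>z\<close>: the product tends to 1 at infinity and has at
  most simple poles at the \<open>y j\<close>, with residues \<open>- shift_ratio k y j\<close>. The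
  next two lemmas are its coefficients of \<open>1/z\<close> and \<open>1/z^2\<close> at infinity;
  they are proved by induction, with \<open>z = y k\<close>.\<close>

lemma shift_ratio_partial_fractions:
  fixes z :: real
  assumes "inj_on y {..<k}" "\<And>i. i < k \<Longrightarrow> y i \<noteq> z"
  shows "(\<Sum>j<k. shift_ratio k y j / (y j - z)) = (\<Prod>i<k. 1 - 1 / (z - y i)) - 1"
  using assms
proof (induction k arbitrary: z)
  case (Suc k)
  let ?P = "\<lambda>z. \<Prod>i<k. 1 - 1 / (z - y i)"
  have inj: "inj_on y {..<k}" using Suc.prems(1) by (auto simp: inj_on_def)
  have ne: "y i \<noteq> y k" if "i < k" for i
    using inj_on_lessThan_Suc_neq[OF Suc.prems(1) that] .
  have nz: "y i \<noteq> z" if "i \<le> k" for i using Suc.prems(2) that by auto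
  \<comment> \<open>Splitting \<open>1 / ((y j - y k) * (y j - z))\<close> makes the induction
    hypothesis applicable at both \<open>z\<close> and \<open>y k\<close>.\<close>
  have "(\<Sum>j<k. shift_ratio (Suc k) y j / (y j - z)) =
        (\<Sum>j<k. shift_ratio k y j / (y j - z)
           - (shift_ratio k y j / (y j - y k) - shift_ratio k y j / (y j - z)) / (y k - z))"
  proof (intro sum.cong refl)
    fix j assume "j \<in> {..<k}"
    then have "j < k" "y j \<noteq> y k" "y j \<noteq> z" "y k \<noteq> z" using ne nz by auto
    then show "shift_ratio (Suc k) y j / (y j - z) = shift_ratio k y j / (y j - z)
           - (shift_ratio k y j / (y j - y k) - shift_ratio k y j / (y j - z)) / (y k - z)"
      by (simp add: shift_ratio_Suc divide_simps) (simp add: algebra_simps)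
  qed
  also have "\<dots> = (?P z - 1) - ((?P (y k) - 1) - (?P z - 1)) / (y k - z)"
    using Suc.IH[OF inj, of z] Suc.IH[OF inj, of "y k"] ne nz
    by (simp add: sum_subtractf sum_divide_distrib[symmetric])
  finally have sum: "(\<Sum>j<k. shift_ratio (Suc k) y j / (y j - z)) = \<dots>" .
  define p q where "p = ?P z" and "q = ?P (y k)"
  have "(p - 1) - ((q - 1) - (p - 1)) / (y k - z) + q / (y k - z) = p * (1 - 1 / (z - y k)) - 1"
    using nz[of k] by (simp add: divide_simps) (simp add: algebra_simps)
  then show ?case
    using sum by (simp add: shift_ratio_Suc_last p_def q_def)
qed simp

lemma sum_shift_ratio:
  assumes "inj_on y {..<k}"
  shows "(\<Sum>j<k. shift_ratio k y j) = real k"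
  using assms
proof (induction k)
  case (Suc k)
  have inj: "inj_on y {..<k}" using Suc.prems by (auto simp: inj_on_def)
  have "(\<Sum>j<k. shift_ratio (Suc k) y j) = (\<Sum>j<k. shift_ratio k y j - shift_ratio k y j / (y j - y k))"
    by (intro sum.cong refl) (auto simp: shift_ratio_Suc algebra_simps)
  also have "\<dots> = real k - ((\<Prod>i<k. 1 - 1 / (y k - y i)) - 1)"
    using Suc.IH[OF inj] shift_ratio_partial_fractions[OF inj, of "y k"]
      inj_on_lessThan_Suc_neq[OF Suc.prems]
    by (simp add: sum_subtractf)
  finally show ?case by (simp add: shift_ratio_Suc_last)
qed simp

lemma sum_mult_shift_ratio:
  assumes "inj_on y {..<k}"
  shows "(\<Sum>j<k. y j * shift_ratio k y j) = (\<Sum>j<k. y j - real j)"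
  using assms
proof (induction k)
  case (Suc k)
  let ?P = "\<Prod>i<k. 1 - 1 / (y k - y i)"
  have inj: "inj_on y {..<k}" using Suc.prems by (auto simp: inj_on_def)
  have "(\<Sum>j<k. y j * shift_ratio (Suc k) y j) =
        (\<Sum>j<k. y j * shift_ratio k y j - shift_ratio k y j - y k * (shift_ratio k y j / (y j - y k)))"
  proof (intro sum.cong refl)
    fix j assume "j \<in> {..<k}"
    then have "j < k" "y j \<noteq> y k" using inj_on_lessThan_Suc_neq[OF Suc.prems] by auto
    then show "y j * shift_ratio (Suc k) y j =
        y j * shift_ratio k y j - shift_ratio k y j - y k * (shift_ratio k y j / (y j - y k))"
      by (simp add: shift_ratio_Suc divide_simps) (simp add: algebra_simps)
  qed
  also have "\<dots> = (\<Sum>j<k. y j - real j) - real k - y k * (?P - 1)"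
    using Suc.IH[OF inj] shift_ratio_partial_fractions[OF inj, of "y k"] sum_shift_ratio[OF inj]
      inj_on_lessThan_Suc_neq[OF Suc.prems]
    by (simp add: sum_subtractf flip: sum_distrib_left times_divide_eq_right)
  finally show ?case by (simp add: shift_ratio_Suc_last algebra_simps)
qed simp

section \<open>Vandermonde products under a unit shift\<close>

definition vandermonde_prod :: "nat \<Rightarrow> (nat \<Rightarrow> real) \<Rightarrow> real" where
  "vandermonde_prod k y = (\<Prod>j<k. \<Prod>i<j. y i - y j)"

lemma vandermonde_prod_eq_0:
  assumes "i < j" "j < k" "y i = y j"
  shows "vandermonde_prod k y = 0"
  using assms unfolding vandermonde_prod_def by (intro prod_zero bexI[of _ j] bexI[of _ i]) auto

lemma vandermonde_prod_shift:
  assumes "inj_on y {..<k}" "j < k"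
  shows "vandermonde_prod k (y(j := y j - 1)) = vandermonde_prod k y * shift_ratio k y j"
  using assms
proof (induction k)
  case (Suc k)
  let ?y = "y(j := y j - 1)"
  have inj: "inj_on y {..<k}" using Suc.prems by (auto simp: inj_on_def)
  note ne = inj_on_lessThan_Suc_neq[OF Suc.prems(1)]
  show ?case
  proof (cases "j = k")
    case True
    have "vandermonde_prod k ?y = vandermonde_prod k y" unfolding vandermonde_prod_def using True by (intro prod.cong) auto
    moreover have "(\<Prod>i<k. ?y i - ?y k) = (\<Prod>i<k. y i - y k) * (\<Prod>i<k. 1 - 1 / (y k - y i))"
      unfolding prod.distrib[symmetric]
    proof (intro prod.cong refl)
      fix i assume "i \<in> {..<k}"
      then have "y i \<noteq> y k" using ne by simp
      then show "?y i - ?y k = (y i - y k) * (1 - 1 / (y k - y i))"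
        using True \<open>i \<in> {..<k}\<close> by (auto simp: divide_simps) (simp add: algebra_simps)
    qed
    ultimately show ?thesis using True by (simp add: vandermonde_prod_def shift_ratio_Suc_last)
  next
    case False
    with Suc.prems have j: "j < k" by simp
    have "(\<Prod>i<k. ?y i - ?y k) = (\<Prod>i<k. (y i - y k) * (if i = j then 1 - 1 / (y j - y k) else 1))"
      using False ne by (intro prod.cong) (auto simp: field_simps)
    also have "\<dots> = (\<Prod>i<k. y i - y k) * (1 - 1 / (y j - y k))"
      using j by (simp add: prod.distrib)
    finally show ?thesis using Suc.IH[OF inj j] j
      by (simp add: vandermonde_prod_def shift_ratio_Suc)
  qed
qed simp

lemma prod_lessThan_diff: "(\<Prod>i<j. real (j - i)) = fact j"
  using fact_prod_rev[of j, where ?'a = real] by (simp add: atLeast0LessThan)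

text \<open>The corner recursion behind Frobenius' formula: if the \<open>y j\<close> are the
  shifted row lengths \<open>a j + r - j\<close>, the first factor on the right is the number of
  boxes of the diagram.\<close>

lemma vandermonde_prod_exchange_sum:
  assumes "inj_on y {..<k}"
  shows "(\<Sum>j<k. y j * vandermonde_prod k (y(j := y j - 1))) = (\<Sum>j<k. y j - real j) * vandermonde_prod k y"
proof -
  have "(\<Sum>j<k. y j * vandermonde_prod k (y(j := y j - 1))) = (\<Sum>j<k. y j * shift_ratio k y j) * vandermonde_prod k y"
    unfolding sum_distrib_right using assms by (intro sum.cong) (auto simp: vandermonde_prod_shift)
  then show ?thesis using sum_mult_shift_ratio[OF assms] by simp
qed

section \<open>Ballot words and Frobenius' formula\<close>

text \<open>Words are read from the right: the head is the most recent letter.\<close>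

fun ballot :: "nat \<Rightarrow> nat list \<Rightarrow> bool" where
  "ballot r [] \<longleftrightarrow> True"
| "ballot r (j # w) \<longleftrightarrow> ballot r w \<and> j \<le> r \<and> (0 < j \<longrightarrow> count_list w j < count_list w (j - 1))"

lemma ballot_count_antimono:
  assumes "ballot r w" "i \<le> j"
  shows "count_list w j \<le> count_list w i"
proof -
  have "count_list w (Suc i) \<le> count_list w i" for i
    using assms(1)
  proof (induction w)
    case (Cons a w)
    then show ?case by (cases "a = Suc i") auto
  qed simp
  then show ?thesis using assms(2) by (rule lift_Suc_antimono_le)
qed

lemma ballot_set: "ballot r w \<Longrightarrow> set w \<subseteq> {..r}"
  by (induction w) auto

lemma ballot_length: "ballot r w \<Longrightarrow> length w = (\<Sum>j\<le>r. count_list w j)"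
  using sum_count_set[of w "{..r}"] ballot_set[of r w] by simp

text \<open>For weakly decreasing \<open>a\<close>, these are the standard Young tableaux with row
  lengths \<open>a j\<close>: the \<open>t\<close>th letter from the right is the row that receives
  the entry \<open>t\<close>.\<close>

definition ballot_words :: "nat \<Rightarrow> (nat \<Rightarrow> nat) \<Rightarrow> nat list set" where
  "ballot_words r a = {w. ballot r w \<and> (\<forall>j\<le>r. count_list w j = a j)}"

lemma finite_ballot_words: "finite (ballot_words r a)"
proof (rule finite_subset)
  show "ballot_words r a \<subseteq> {w. set w \<subseteq> {..r} \<and> length w = (\<Sum>j\<le>r. a j)}"
    unfolding ballot_words_def using ballot_length ballot_set by fastforce
qed (rule finite_lists_length_eq, simp)

text \<open>The rows that end in a corner, so that removing their last box leaves a Young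
  diagram.\<close>

definition removable :: "nat \<Rightarrow> (nat \<Rightarrow> nat) \<Rightarrow> nat set" where
  "removable r a = {j. j \<le> r \<and> 0 < a j \<and> (j < r \<longrightarrow> a (Suc j) < a j)}"

text \<open>The largest entry of a tableau occupies a corner, and deleting it gives an arbitrary
  tableau of the remaining shape.\<close>

lemma ballot_words_rec:
  assumes anti: "\<And>j. j < r \<Longrightarrow> a (Suc j) \<le> a j" and pos: "0 < (\<Sum>j\<le>r. a j)"
  shows "ballot_words r a = (\<Union>j\<in>removable r a. (#) j ` ballot_words r (a(j := a j - 1)))"
proof (intro equalityI subsetI)
  fix w assume w: "w \<in> ballot_words r a"
  then have b: "ballot r w" and c: "\<And>j. j \<le> r \<Longrightarrow> count_list w j = a j"
    by (auto simp: ballot_words_def)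
  have "length w > 0" using ballot_length[OF b] c pos by simp
  then obtain j u where ju: "w = j # u" by (cases w) auto
  have bu: "ballot r u" "j \<le> r" using b ju by auto
  \<comment> \<open>Row \<open>j\<close> was at least as long as row \<open>j + 1\<close> already
    before the last letter lengthened it.\<close>
  have "a (Suc j) < a j" if "j < r"
    using ballot_count_antimono[OF bu(1), of j "Suc j"] c[of j] c[of "Suc j"] that ju by auto
  moreover have "0 < a j" using c[OF bu(2)] ju by simp
  ultimately have "j \<in> removable r a" using bu by (simp add: removable_def)
  moreover have "u \<in> ballot_words r (a(j := a j - 1))"
    using bu c[of j] c ju by (auto simp: ballot_words_def)
      (metis One_nat_def count_list.simps(2))
  ultimately show "w \<in> (\<Union>j\<in>removable r a. (#) j ` ballot_words r (a(j := a j - 1)))"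
    using ju by blast
next
  fix w assume "w \<in> (\<Union>j\<in>removable r a. (#) j ` ballot_words r (a(j := a j - 1)))"
  then obtain j u where j: "j \<in> removable r a" and u: "u \<in> ballot_words r (a(j := a j - 1))"
    and w: "w = j # u" by blast
  have jr: "j \<le> r" "0 < a j" using j by (auto simp: removable_def)
  have c: "count_list u i = (a(j := a j - 1)) i" if "i \<le> r" for i
    using u that by (auto simp: ballot_words_def)
  have "count_list u j < count_list u (j - 1)" if "0 < j"
    using c[of j] c[of "j - 1"] jr that anti[of "j - 1"]
    by (metis (no_types, lifting) One_nat_def Suc_pred diff_le_self fun_upd_apply le_trans less_le_trans
        diff_less less_Suc_eq_le nat_less_le zero_less_one)
  then show "w \<in> ballot_words r a"
    using u w c jr by (auto simp: ballot_words_def)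
qed

lemma card_ballot_words_rec:
  assumes "\<And>j. j < r \<Longrightarrow> a (Suc j) \<le> a j" and "0 < (\<Sum>j\<le>r. a j)"
  shows "card (ballot_words r a) = (\<Sum>j\<in>removable r a. card (ballot_words r (a(j := a j - 1))))"
proof -
  have "finite (removable r a)" by (rule finite_subset[of _ "{..r}"]) (auto simp: removable_def)
  then have "card (\<Union>j\<in>removable r a. (#) j ` ballot_words r (a(j := a j - 1))) =
        (\<Sum>j\<in>removable r a. card ((#) j ` ballot_words r (a(j := a j - 1))))"
    by (intro card_UN_disjoint) (auto simp: finite_ballot_words)
  then have "card (ballot_words r a) =
        (\<Sum>j\<in>removable r a. card ((#) j ` ballot_words r (a(j := a j - 1))))"
    by (simp only: ballot_words_rec[of r a, OF assms])
  then show ?thesis by (simp add: card_image)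
qed

lemma removable_antimono:
  assumes "\<And>j. j < r \<Longrightarrow> a (Suc j) \<le> a j" "j \<in> removable r a" "i < r"
  shows "(a(j := a j - 1)) (Suc i) \<le> (a(j := a j - 1)) i"
  using assms(1)[OF assms(3)] assms(2,3) by (auto simp: removable_def)

text \<open>Both sides satisfy the same recursion over corners, so induction on the number of boxes
  applies.\<close>

theorem card_ballot_words:
  fixes a :: "nat \<Rightarrow> nat" and r :: nat
  defines "y \<equiv> \<lambda>a j. a j + r - j"
  assumes "\<And>j. j < r \<Longrightarrow> a (Suc j) \<le> a j"
  shows "real (card (ballot_words r a)) =
    fact (\<Sum>j\<le>r. a j) * vandermonde_prod (Suc r) (\<lambda>j. real (y a j)) / (\<Prod>j\<le>r. fact (y a j))"
  using assms(2)
proof (induction "\<Sum>j\<le>r. a j" arbitrary: a)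
  case 0
  then have a0: "a j = 0" if "j \<le> r" for j using that by auto
  have "w = []" if "w \<in> ballot_words r a" for w
    using that a0 ballot_length[of r w] by (simp add: ballot_words_def)
  then have "ballot_words r a = {[]}"
    using a0 by (auto simp: ballot_words_def)
  \<comment> \<open>For the empty diagram the \<open>y a j\<close> are \<open>r, ..., 0\<close>, and
    both products equal the product of the factorials up to \<open>r\<close>.\<close>
  moreover have "vandermonde_prod (Suc r) (\<lambda>j. real (y a j)) = (\<Prod>j\<le>r. fact (y a j))"
  proof -
    have "vandermonde_prod (Suc r) (\<lambda>j. real (y a j)) = (\<Prod>j\<le>r. \<Prod>i<j. real (j - i))"
      unfolding vandermonde_prod_def lessThan_Suc_atMost using a0 by (intro prod.cong) (auto simp: y_def)
    also have "\<dots> = (\<Prod>j\<le>r. fact j)" by (simp only: prod_lessThan_diff)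
    also have "\<dots> = (\<Prod>j\<le>r. fact (r - j))"
      by (rule prod.reindex_bij_witness[of _ "\<lambda>j. r - j" "\<lambda>j. r - j"]) auto
    finally show ?thesis using a0 by (simp add: y_def)
  qed
  ultimately show ?case using 0 by simp
next
  case (Suc n)
  note anti = Suc.prems
  let ?y = "\<lambda>j. real (y a j)"
  let ?Q = "\<Prod>j\<le>r. fact (y a j) :: real"
  have mono: "a j \<le> a i" if "i \<le> j" "j \<le> r" for i j
    using that by (induction rule: dec_induct) (auto intro: order_trans[OF anti])
  have yless: "y a j < y a i" if "i < j" "j \<le> r" for i j
    using mono[of i j] that by (auto simp: y_def)
  have inj: "inj_on ?y {..<Suc r}"
    by (auto simp: inj_on_def) (metis yless less_Suc_eq_le linorder_neqE_nat nat_neq_iff)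
  have pos: "0 < (\<Sum>j\<le>r. a j)" using Suc.hyps(2) by simp
  have yupd: "(\<lambda>i. real (y (a(j := a j - 1)) i)) = ?y(j := ?y j - 1)" if "0 < a j" "j \<le> r" for j
    using that by (auto simp: y_def fun_eq_iff of_nat_diff)
  \<comment> \<open>Rows without a corner contribute nothing: either lowering \<open>y j\<close>
    makes it equal to \<open>y (Suc j)\<close>, or \<open>j = r\<close> and the weight
    \<open>y j\<close> is zero. Hence the sum over corners extends to all rows.\<close>
  have vanish: "?y j * vandermonde_prod (Suc r) (?y(j := ?y j - 1)) = 0" if j: "j \<le> r" "j \<notin> removable r a" for j
  proof (cases "j = r")
    case True
    then have "a j = 0" using j by (auto simp: removable_def)
    then show ?thesis using True by (simp add: y_def)
  next
    case False
    then have "j < r" using j by simp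
    then have "a (Suc j) = a j" using j anti[of j] by (auto simp: removable_def)
    then have "?y (Suc j) = ?y j - 1" using \<open>j < r\<close> by (auto simp: y_def)
    then show ?thesis using \<open>j < r\<close> vandermonde_prod_eq_0[of j "Suc j" "Suc r" "?y(j := ?y j - 1)"] by simp
  qed
  have IH: "real (card (ballot_words r (a(j := a j - 1)))) =
      fact n * (?y j * vandermonde_prod (Suc r) (?y(j := ?y j - 1))) / ?Q" if j: "j \<in> removable r a" for j
  proof -
    have jr: "j \<le> r" "0 < a j" using j by (auto simp: removable_def)
    have "(\<Sum>i\<le>r. a i) = a j + (\<Sum>i\<in>{..r} - {j}. a i)" using jr by (simp add: sum.remove)
    moreover have "(\<Sum>i\<le>r. (a(j := a j - 1)) i) = (a j - 1) + (\<Sum>i\<in>{..r} - {j}. a i)"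
      using jr by (simp add: sum.remove[of _ j])
    ultimately have n: "n = (\<Sum>i\<le>r. (a(j := a j - 1)) i)" using Suc.hyps(2) jr by simp
    have "?Q = fact (y a j) * (\<Prod>i\<in>{..r} - {j}. fact (y a i))" using jr by (simp add: prod.remove)
    moreover have "(\<Prod>i\<le>r. fact (y (a(j := a j - 1)) i)) =
        (fact (y a j - 1) * (\<Prod>i\<in>{..r} - {j}. fact (y a i)) :: real)"
      using jr by (simp add: prod.remove[of _ j] y_def)
    \<comment> \<open>The weight \<open>y j\<close> of the exchange identity is the factor that the
      factorial in the denominator loses.\<close>
    moreover have "fact (y a j) = (?y j * fact (y a j - 1) :: real)"
      using jr by (intro fact_reduce) (auto simp: y_def)
    ultimately have Q: "?Q = ?y j * (\<Prod>i\<le>r. fact (y (a(j := a j - 1)) i))" by simp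
    have "?y j \<noteq> 0" using jr by (simp add: y_def)
    moreover have "real (card (ballot_words r (a(j := a j - 1)))) =
        fact n * vandermonde_prod (Suc r) (?y(j := ?y j - 1)) / (\<Prod>i\<le>r. fact (y (a(j := a j - 1)) i))"
      using Suc.hyps(1)[OF n removable_antimono[OF anti j]]
      unfolding yupd[OF jr(2,1)] n[symmetric] .
    ultimately show ?thesis unfolding Q by (simp del: fun_upd_apply)
  qed
  have "real (card (ballot_words r a)) = (\<Sum>j\<in>removable r a. real (card (ballot_words r (a(j := a j - 1)))))"
    using card_ballot_words_rec[OF anti pos] by simp
  also have "\<dots> = (\<Sum>j\<in>removable r a. fact n * (?y j * vandermonde_prod (Suc r) (?y(j := ?y j - 1))) / ?Q)"
    using IH by (intro sum.cong) auto
  also have "\<dots> = (\<Sum>j\<le>r. fact n * (?y j * vandermonde_prod (Suc r) (?y(j := ?y j - 1))) / ?Q)"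
  proof (rule sum.mono_neutral_left)
    show "\<forall>i\<in>{..r} - removable r a. fact n * (?y i * vandermonde_prod (Suc r) (?y(i := ?y i - 1))) / ?Q = 0"
      using vanish by fastforce
  qed (auto simp: removable_def)
  also have "\<dots> = fact n * (\<Sum>j<Suc r. ?y j * vandermonde_prod (Suc r) (?y(j := ?y j - 1))) / ?Q"
    by (simp only: sum_distrib_left sum_divide_distrib lessThan_Suc_atMost)
  also have "(\<Sum>j<Suc r. ?y j * vandermonde_prod (Suc r) (?y(j := ?y j - 1))) =
      (\<Sum>j<Suc r. ?y j - real j) * vandermonde_prod (Suc r) ?y"
    by (rule vandermonde_prod_exchange_sum[OF inj])
  also have "(\<Sum>j<Suc r. ?y j - real j) = real (Suc n)"
  proof -
    have "(\<Sum>j<Suc r. ?y j - real j) = (\<Sum>j\<le>r. real (a j) + (real (r - j) - real j))"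
      unfolding lessThan_Suc_atMost by (intro sum.cong) (auto simp: y_def of_nat_diff)
    also have "\<dots> = (\<Sum>j\<le>r. real (a j)) + ((\<Sum>j\<le>r. real (r - j)) - (\<Sum>j\<le>r. real j))"
      by (simp only: sum.distrib sum_subtractf)
    also have "(\<Sum>j\<le>r. real (r - j)) = (\<Sum>j\<le>r. real j)"
      by (rule sum.reindex_bij_witness[of _ "\<lambda>j. r - j" "\<lambda>j. r - j"]) auto
    finally show ?thesis using Suc.hyps(2) by (metis add_0_right diff_self of_nat_sum)
  qed
  finally show ?case by (simp flip: Suc.hyps(2) add: mult_ac)
qed

corollary card_ballot_words_rectangle:
  "real (card (ballot_words r (\<lambda>_. s))) = fact ((r + 1) * s) * (\<Prod>i=0..r. fact i / fact (s + i))"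
proof -
  have "vandermonde_prod (Suc r) (\<lambda>j. real (s + r - j)) = (\<Prod>j\<le>r. \<Prod>i<j. real (j - i))"
    unfolding vandermonde_prod_def lessThan_Suc_atMost by (intro prod.cong) auto
  also have "\<dots> = (\<Prod>j\<le>r. fact j)" by (simp only: prod_lessThan_diff)
  moreover have "(\<Prod>j\<le>r. fact (s + r - j)) = (\<Prod>j\<le>r. fact (s + j) :: real)"
    by (rule prod.reindex_bij_witness[of _ "\<lambda>j. r - j" "\<lambda>j. r - j"]) auto
  ultimately show ?thesis
    by (simp add: card_ballot_words prod_dividef atLeast0AtMost)
qed


section \<open>Weighted degrees of divisors\<close>

text \<open>The linear extension of \<open>\<phi>\<close> to divisors. Degree and the loop
  coordinates are both of this form, so one formula for principal divisors serves both.\<close>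

definition wsum :: "('a \<Rightarrow> real) \<Rightarrow> ('a \<Rightarrow>\<^sub>0 int) \<Rightarrow> real" where
  "wsum \<phi> D = (\<Sum>p\<in>Poly_Mapping.keys D. of_int (Poly_Mapping.lookup D p) * \<phi> p)"

lemma wsum_superset:
  assumes "finite K" "Poly_Mapping.keys D \<subseteq> K"
  shows "wsum \<phi> D = (\<Sum>p\<in>K. of_int (Poly_Mapping.lookup D p) * \<phi> p)"
  unfolding wsum_def using assms by (intro sum.mono_neutral_left) (auto simp: in_keys_iff)

lemma wsum_0 [simp]: "wsum \<phi> 0 = 0"
  by (simp add: wsum_def)

lemma wsum_add [simp]: "wsum \<phi> (A + B) = wsum \<phi> A + wsum \<phi> B"
proof -
  let ?K = "Poly_Mapping.keys A \<union> Poly_Mapping.keys B"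
  have "Poly_Mapping.keys (A + B) \<subseteq> ?K" by (rule keys_add)
  then have "wsum \<phi> (A + B) = (\<Sum>p\<in>?K. of_int (Poly_Mapping.lookup (A + B) p) * \<phi> p)"
    by (intro wsum_superset) auto
  moreover have "wsum \<phi> A = (\<Sum>p\<in>?K. of_int (Poly_Mapping.lookup A p) * \<phi> p)"
    "wsum \<phi> B = (\<Sum>p\<in>?K. of_int (Poly_Mapping.lookup B p) * \<phi> p)"
    by (auto intro!: wsum_superset)
  ultimately show ?thesis
    by (simp add: lookup_add sum.distrib[symmetric] distrib_right)
qed

lemma wsum_uminus [simp]: "wsum \<phi> (- A) = - wsum \<phi> A"
  by (simp add: wsum_def sum_negf)

lemma wsum_diff [simp]: "wsum \<phi> (A - B) = wsum \<phi> A - wsum \<phi> B"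
  using wsum_add[of \<phi> A "- B"] by simp

lemma wsum_frag_of [simp]: "wsum \<phi> (frag_of p) = \<phi> p"
  by (simp add: wsum_def)

lemma wsum_frag_cmul [simp]: "wsum \<phi> (frag_cmul c A) = of_int c * wsum \<phi> A"
  unfolding wsum_superset[OF finite_keys keys_cmul]
  by (simp add: wsum_def sum_distrib_left mult.assoc)

lemma div_degree_wsum: "of_int (div_degree D) = wsum (\<lambda>_. 1) D"
  by (simp add: div_degree_def wsum_def)

lemma wsum_const:
  assumes "\<And>p. p \<in> Poly_Mapping.keys D \<Longrightarrow> \<phi> p = c"
  shows "wsum \<phi> D = c * of_int (div_degree D)"
  using assms by (simp add: wsum_def div_degree_def sum_distrib_left mult.commute)

lemma div_degree_add [simp]: "div_degree (A + B) = div_degree A + div_degree B"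
  using wsum_add[of "\<lambda>_. 1" A B] by (simp flip: div_degree_wsum of_int_add)

lemma div_degree_diff [simp]: "div_degree (A - B) = div_degree A - div_degree B"
  using wsum_diff[of "\<lambda>_. 1" A B] by (simp flip: div_degree_wsum of_int_diff)

lemma div_degree_frag_of [simp]: "div_degree (frag_of p) = 1"
  by (simp add: div_degree_def)

lemma div_degree_frag_cmul [simp]: "div_degree (frag_cmul c A) = c * div_degree A"
  using wsum_frag_cmul[of "\<lambda>_. 1" c A] by (simp flip: div_degree_wsum of_int_mult)


section \<open>Slopes and summation by parts\<close>

lemma eventually_at_left_less: "\<forall>\<^sub>F s in at_left t. s < t"
  by (simp add: eventually_at_filter)

lemma left_slopeI:
  assumes "a < t" "\<And>s. a < s \<Longrightarrow> s < t \<Longrightarrow> f s = f t + of_int k * (s - t)"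
  shows "left_slope f t = k"
  unfolding left_slope_def
proof (rule the_equality)
  show k: "\<forall>\<^sub>F s in at_left t. f s = f t + of_int k * (s - t)"
    unfolding eventually_at_left[OF assms(1)] using assms by blast
  fix k' assume "\<forall>\<^sub>F s in at_left t. f s = f t + of_int k' * (s - t)"
  then have "\<forall>\<^sub>F s in at_left t. s < t \<and> of_int k' * (s - t) = of_int k * (s - t)"
    using k eventually_at_left_less
    by eventually_elim simp
  then show "k' = k" using eventually_happens'[OF trivial_limit_at_left_real] by fastforce
qed

lemma right_slopeI:
  assumes "t < b" "\<And>s. t < s \<Longrightarrow> s < b \<Longrightarrow> f s = f t + of_int k * (s - t)"
  shows "right_slope f t = k"
  unfolding right_slope_def
proof (rule the_equality)
  show k: "\<forall>\<^sub>F s in at_right t. f s = f t + of_int k * (s - t)"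
    unfolding eventually_at_right[OF assms(1)] using assms by blast
  fix k' assume "\<forall>\<^sub>F s in at_right t. f s = f t + of_int k' * (s - t)"
  then have "\<forall>\<^sub>F s in at_right t. t < s \<and> of_int k' * (s - t) = of_int k * (s - t)"
    using k eventually_at_right_less[of t]
    by eventually_elim simp
  then show "k' = k" using eventually_happens'[OF trivial_limit_at_right_real] by fastforce
qed

lemma linear_int_slope_onE:
  assumes "linear_int_slope_on a b f"
  obtains k where "a \<le> b \<Longrightarrow> f b - f a = of_int k * (b - a)"
    and "\<And>t. a < t \<Longrightarrow> t \<le> b \<Longrightarrow> left_slope f t = k"
    and "\<And>t. a \<le> t \<Longrightarrow> t < b \<Longrightarrow> right_slope f t = k"
proof -
  obtain k :: int where k: "\<And>t. t \<in> {a..b} \<Longrightarrow> f t = f a + of_int k * (t - a)"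
    using assms unfolding linear_int_slope_on_def by blast
  have lin: "f t = f s + of_int k * (t - s)" if "s \<in> {a..b}" "t \<in> {a..b}" for s t
    using k[OF that(1)] k[OF that(2)] by (simp add: algebra_simps)
  show thesis
  proof (rule that[of k])
    show "left_slope f t = k" if "a < t" "t \<le> b" for t
      by (rule left_slopeI[OF that(1)], rule lin) (use that in auto)
    show "right_slope f t = k" if "a \<le> t" "t < b" for t
      by (rule right_slopeI[OF that(2)], rule lin) (use that in auto)
    show "f b - f a = of_int k * (b - a)" if "a \<le> b"
      using that lin[of a b] by simp
  qed
qed

lemma finite_gap:
  fixes t :: real
  assumes "finite S" "a < t" "t < b"
  obtains c d where "a \<le> c" "c < t" "t < d" "d \<le> b" "({c<..<d} - {t}) \<inter> S = {}"
proof -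
  obtain e where e: "0 < e" "\<And>x. x \<in> S \<Longrightarrow> x \<noteq> t \<Longrightarrow> e \<le> dist t x"
    using finite_set_avoid[OF assms(1), of t] by auto
  show thesis
  proof
    show "({max a (t - e)<..<min b (t + e)} - {t}) \<inter> S = {}"
      using e(2) by (fastforce simp: dist_real_def)
  qed (use e assms in auto)
qed

lemma slopes_eq_off_breaks:
  assumes "finite S"
    and lin: "\<And>a b. 0 \<le> a \<Longrightarrow> a \<le> b \<Longrightarrow> b \<le> L \<Longrightarrow> {a<..<b} \<inter> S = {} \<Longrightarrow> linear_int_slope_on a b f"
    and "0 < t" "t < L" "t \<notin> S"
  shows "left_slope f t = right_slope f t"
proof -
  obtain c d where cd: "0 \<le> c" "c < t" "t < d" "d \<le> L" "({c<..<d} - {t}) \<inter> S = {}"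
    using finite_gap[OF assms(1,3,4)] .
  then have "linear_int_slope_on c d f" using \<open>t \<notin> S\<close> by (intro lin) auto
  then show ?thesis by (rule linear_int_slope_onE) (use cd in auto)
qed

text \<open>Green's formula on an interval: the bends play the role of minus the second derivative
  of \<open>f\<close>, and an affine weight has second derivative zero, so only boundary terms
  remain.\<close>

lemma slope_summation_by_parts:
  fixes L :: real
  assumes "finite S" "0 < L"
    and "\<And>a b. 0 \<le> a \<Longrightarrow> a \<le> b \<Longrightarrow> b \<le> L \<Longrightarrow> {a<..<b} \<inter> S = {} \<Longrightarrow> linear_int_slope_on a b f"
  shows "of_int (left_slope f L) * (\<alpha> + \<beta> * L) - of_int (right_slope f 0) * \<alpha>
    + (\<Sum>t\<in>S \<inter> {0<..<L}. of_int (left_slope f t - right_slope f t) * (\<alpha> + \<beta> * t)) = \<beta> * (f L - f 0)"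
  using assms(2,3)
proof (induction "card (S \<inter> {0<..<L})" arbitrary: L rule: less_induct)
  case less
  show ?case
  proof (cases "S \<inter> {0<..<L} = {}")
    case True
    then have "linear_int_slope_on 0 L f" using less.prems by (intro less.prems(2)) auto
    then obtain k where "f L - f 0 = of_int k * (L - 0)" "left_slope f L = k" "right_slope f 0 = k"
      by (rule linear_int_slope_onE) (use \<open>0 < L\<close> in auto)
    then show ?thesis unfolding True by (simp add: algebra_simps)
  next
    case False
    \<comment> \<open>The interval is cut at its last break: \<open>f\<close> is linear beyond
      \<open>M\<close>, and \<open>[0, M]\<close> has one interior break fewer.\<close>
    define M where "M = Max (S \<inter> {0<..<L})"
    have fin: "finite (S \<inter> {0<..<L})" using assms(1) by simp
    have M: "M \<in> S" "0 < M" "M < L" using Max_in[OF fin False] by (auto simp: M_def)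
    have above: "{M<..<L} \<inter> S = {}"
      using Max_ge[OF fin] M by (fastforce simp: M_def[symmetric])
    have split: "S \<inter> {0<..<L} = insert M (S \<inter> {0<..<M})"
      using M above by auto (metis IntI empty_iff greaterThanLessThan_iff linorder_neqE_linordered_idom)
    have "card (S \<inter> {0<..<M}) < card (S \<inter> {0<..<L})"
      unfolding split using assms(1) by (simp add: card_insert_if)
    then have IH: "of_int (left_slope f M) * (\<alpha> + \<beta> * M) - of_int (right_slope f 0) * \<alpha>
      + (\<Sum>t\<in>S \<inter> {0<..<M}. of_int (left_slope f t - right_slope f t) * (\<alpha> + \<beta> * t)) = \<beta> * (f M - f 0)"
      by (rule less.hyps) (use M less.prems(2) in auto)
    have "linear_int_slope_on M L f" using M above by (intro less.prems(2)) auto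
    then obtain k where k: "f L - f M = of_int k * (L - M)" "left_slope f L = k" "right_slope f M = k"
      by (rule linear_int_slope_onE) (use M in auto)
    define X where
      "X = (\<Sum>t\<in>S \<inter> {0<..<M}. of_int (left_slope f t - right_slope f t) * (\<alpha> + \<beta> * t))"
    have sum: "(\<Sum>t\<in>S \<inter> {0<..<L}. of_int (left_slope f t - right_slope f t) * (\<alpha> + \<beta> * t)) =
        of_int (left_slope f M - k) * (\<alpha> + \<beta> * M) + X"
      unfolding split using assms(1) k(3) by (simp add: X_def)
    have "f L - f 0 = (f M - f 0) + of_int k * (L - M)" using k(1) by simp
    then have "\<beta> * (f L - f 0) = \<beta> * (f M - f 0) + \<beta> * (of_int k * (L - M))"
      by (simp only: distrib_left)
    then show ?thesis unfolding sum k(2) using IH[folded X_def]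
      by (simp add: algebra_simps)
  qed
qed

section \<open>Principal divisors on a finite metric graph\<close>

locale finite_metric_graph =
  fixes G :: "('v, 'e) metric_graph"
  assumes finite_verts: "finite (verts G)"
    and finite_edges: "finite (edges G)"
    and tail_verts: "e \<in> edges G \<Longrightarrow> tail G e \<in> verts G"
    and head_verts: "e \<in> edges G \<Longrightarrow> head G e \<in> verts G"
    and len_pos: "e \<in> edges G \<Longrightarrow> 0 < len G e"
begin

lemma PL_breaks:
  assumes "\<psi> \<in> PL G"
  obtains S where "\<And>e. e \<in> edges G \<Longrightarrow> finite (S e)"
    and "\<And>e. e \<in> edges G \<Longrightarrow> S e \<subseteq> {0<..<len G e}"
    and "\<And>e a b. e \<in> edges G \<Longrightarrow> 0 \<le> a \<Longrightarrow> a \<le> b \<Longrightarrow> b \<le> len G e \<Longrightarrow> {a<..<b} \<inter> S e = {} \<Longrightarrow>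
      linear_int_slope_on a b (\<lambda>t. \<psi> (edge_param G e t))"
proof -
  have "\<forall>e\<in>edges G. \<exists>S. finite S \<and> (\<forall>a b. 0 \<le> a \<and> a \<le> b \<and> b \<le> len G e \<and> {a<..<b} \<inter> S = {} \<longrightarrow>
      linear_int_slope_on a b (\<lambda>t. \<psi> (edge_param G e t)))"
    using assms by (auto simp: PL_def piecewise_linear_int_def)
  then obtain S where S: "\<And>e. e \<in> edges G \<Longrightarrow> finite (S e)"
    "\<And>e a b. e \<in> edges G \<Longrightarrow> 0 \<le> a \<Longrightarrow> a \<le> b \<Longrightarrow> b \<le> len G e \<Longrightarrow> {a<..<b} \<inter> S e = {} \<Longrightarrow>
      linear_int_slope_on a b (\<lambda>t. \<psi> (edge_param G e t))"
    by metis
  show thesis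
  proof (rule that[of "\<lambda>e. S e \<inter> {0<..<len G e}"])
    fix e a b assume e: "e \<in> edges G" and ab: "0 \<le> a" "a \<le> b" "b \<le> len G e"
      and "{a<..<b} \<inter> (S e \<inter> {0<..<len G e}) = {}"
    then have "{a<..<b} \<inter> S e = {}" by auto
    then show "linear_int_slope_on a b (\<lambda>t. \<psi> (edge_param G e t))" using S(2)[OF e ab] by simp
  qed (use S in auto)
qed

lemma ord_support_subset:
  assumes "\<And>e. e \<in> edges G \<Longrightarrow> finite (S e)"
    and "\<And>e a b. e \<in> edges G \<Longrightarrow> 0 \<le> a \<Longrightarrow> a \<le> b \<Longrightarrow> b \<le> len G e \<Longrightarrow> {a<..<b} \<inter> S e = {} \<Longrightarrow>
      linear_int_slope_on a b (\<lambda>t. \<psi> (edge_param G e t))"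
  shows "{p \<in> points G. ord_at G \<psi> p \<noteq> 0} \<subseteq> Vertex ` verts G \<union> (\<Union>e\<in>edges G. Inner e ` S e)"
proof
  fix p assume p: "p \<in> {p \<in> points G. ord_at G \<psi> p \<noteq> 0}"
  show "p \<in> Vertex ` verts G \<union> (\<Union>e\<in>edges G. Inner e ` S e)"
  proof (cases p)
    case (Inner e t)
    then have e: "e \<in> edges G" "0 < t" "t < len G e" using p by (auto simp: points_def)
    have "t \<in> S e"
    proof (rule ccontr)
      assume "t \<notin> S e"
      have "left_slope (\<lambda>t. \<psi> (edge_param G e t)) t = right_slope (\<lambda>t. \<psi> (edge_param G e t)) t"
        by (rule slopes_eq_off_breaks[OF assms(1)[OF e(1)] _ e(2,3) \<open>t \<notin> S e\<close>])
          (rule assms(2)[OF e(1)])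
      then show False using p Inner by simp
    qed
    then show ?thesis using Inner e by auto
  qed (use p in \<open>auto simp: points_def\<close>)
qed

text \<open>A sum over an infinite set defaults to zero; finiteness makes \<open>div_of\<close> the
  divisor with coefficients \<open>ord_at\<close>.\<close>

lemma finite_ord_support:
  assumes "\<psi> \<in> PL G"
  shows "finite {p \<in> points G. ord_at G \<psi> p \<noteq> 0}"
proof -
  obtain S where "\<And>e. e \<in> edges G \<Longrightarrow> finite (S e)"
    and "\<And>e. e \<in> edges G \<Longrightarrow> S e \<subseteq> {0<..<len G e}"
    and "\<And>e a b. e \<in> edges G \<Longrightarrow> 0 \<le> a \<Longrightarrow> a \<le> b \<Longrightarrow> b \<le> len G e \<Longrightarrow> {a<..<b} \<inter> S e = {} \<Longrightarrow>
      linear_int_slope_on a b (\<lambda>t. \<psi> (edge_param G e t))"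
    by (rule PL_breaks[OF assms]) blast
  note S = this
  have "{p \<in> points G. ord_at G \<psi> p \<noteq> 0} \<subseteq> Vertex ` verts G \<union> (\<Union>e\<in>edges G. Inner e ` S e)"
    by (rule ord_support_subset) (fact S(1), fact S(3))
  then show ?thesis
    by (rule finite_subset) (use finite_verts finite_edges S(1) in auto)
qed

lemma lookup_div_of:
  assumes "\<psi> \<in> PL G"
  shows "Poly_Mapping.lookup (div_of G \<psi>) p = (if p \<in> points G then ord_at G \<psi> p else 0)"
proof -
  let ?K = "{p \<in> points G. ord_at G \<psi> p \<noteq> 0}"
  have "Poly_Mapping.lookup (div_of G \<psi>) p = (\<Sum>q\<in>?K. if q = p then ord_at G \<psi> q else 0)"
    unfolding div_of_def lookup_sum by (intro sum.cong) (auto simp: lookup_single)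
  also have "\<dots> = (if p \<in> ?K then ord_at G \<psi> p else 0)"
    by (rule sum.delta[OF finite_ord_support[OF assms]])
  finally show ?thesis by auto
qed

lemma sum_verts_fibre:
  fixes a :: "'e \<Rightarrow> real"
  assumes "\<And>e. e \<in> edges G \<Longrightarrow> h e \<in> verts G"
  shows "(\<Sum>v\<in>verts G. (\<Sum>e | e \<in> edges G \<and> h e = v. a e) * \<phi> v) = (\<Sum>e\<in>edges G. a e * \<phi> (h e))"
proof -
  have "(\<Sum>v\<in>verts G. (\<Sum>e | e \<in> edges G \<and> h e = v. a e) * \<phi> v) =
        (\<Sum>v\<in>verts G. \<Sum>e | e \<in> edges G \<and> h e = v. a e * \<phi> (h e))"
    unfolding sum_distrib_right by (intro sum.cong) auto
  also have "\<dots> = (\<Sum>e\<in>edges G. a e * \<phi> (h e))"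
    using assms by (intro sum.group finite_verts finite_edges) auto
  finally show ?thesis .
qed

text \<open>
  The offset \<open>\<tau>\<close> allows the weight \<open>\<phi>\<close> to be multivalued at the tail of an edge, as the
  angular coordinate on a loop is.
\<close>

theorem wsum_div_of:
  assumes "\<psi> \<in> PL G"
    and inner: "\<And>e t. e \<in> edges G \<Longrightarrow> 0 < t \<Longrightarrow> t < len G e \<Longrightarrow> \<phi> (Inner e t) = \<alpha> e + \<beta> e * t"
    and head: "\<And>e. e \<in> edges G \<Longrightarrow> \<phi> (Vertex (head G e)) = \<alpha> e + \<beta> e * len G e"
    and tail: "\<And>e. e \<in> edges G \<Longrightarrow> \<phi> (Vertex (tail G e)) = \<alpha> e + \<tau> e"
  shows "wsum \<phi> (div_of G \<psi>) = (\<Sum>e\<in>edges G. \<beta> e * (\<psi> (Vertex (head G e)) - \<psi> (Vertex (tail G e)))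
    - of_int (right_slope (\<lambda>t. \<psi> (edge_param G e t)) 0) * \<tau> e)"
proof -
  let ?f = "\<lambda>e t. \<psi> (edge_param G e t)"
  obtain S where S: "\<And>e. e \<in> edges G \<Longrightarrow> finite (S e)"
    "\<And>e. e \<in> edges G \<Longrightarrow> S e \<subseteq> {0<..<len G e}"
    "\<And>e a b. e \<in> edges G \<Longrightarrow> 0 \<le> a \<Longrightarrow> a \<le> b \<Longrightarrow> b \<le> len G e \<Longrightarrow> {a<..<b} \<inter> S e = {} \<Longrightarrow>
      linear_int_slope_on a b (?f e)"
    by (rule PL_breaks[OF assms(1)]) blast
  define K where "K = Vertex ` verts G \<union> (\<Union>e\<in>edges G. Inner e ` S e)"
  have finK: "finite K" unfolding K_def using S(1) finite_verts finite_edges by auto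
  have Kpts: "K \<subseteq> points G" unfolding K_def points_def using S(2) by fastforce
  have keys: "Poly_Mapping.keys (div_of G \<psi>) \<subseteq> K"
  proof -
    have "{p \<in> points G. ord_at G \<psi> p \<noteq> 0} \<subseteq> K"
      unfolding K_def by (rule ord_support_subset) (fact S(1), fact S(3))
    then show ?thesis
      by (auto simp: in_keys_iff lookup_div_of[OF assms(1)] split: if_splits)
  qed
  let ?o = "\<lambda>p. of_int (ord_at G \<psi> p) * \<phi> p"
  have "wsum \<phi> (div_of G \<psi>) = (\<Sum>p\<in>K. ?o p)"
    unfolding wsum_superset[OF finK keys] using Kpts
    by (intro sum.cong) (auto simp: lookup_div_of[OF assms(1)])
  also have "\<dots> = (\<Sum>p\<in>Vertex ` verts G. ?o p) + (\<Sum>p\<in>(\<Union>e\<in>edges G. Inner e ` S e). ?o p)"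
    unfolding K_def using finite_verts finite_edges S(1) by (intro sum.union_disjoint) auto
  also have "(\<Sum>p\<in>Vertex ` verts G. ?o p) = (\<Sum>v\<in>verts G. ?o (Vertex v))"
    by (simp add: sum.reindex inj_on_def)
  \<comment> \<open>Regrouping by edges: every edge sends its last slope to its head and its first
    slope, negated, to its tail.\<close>
  also have "\<dots> = (\<Sum>v\<in>verts G. (\<Sum>e | e \<in> edges G \<and> head G e = v. of_int (left_slope (?f e) (len G e))) * \<phi> (Vertex v))
      - (\<Sum>v\<in>verts G. (\<Sum>e | e \<in> edges G \<and> tail G e = v. of_int (right_slope (?f e) 0)) * \<phi> (Vertex v))"
    by (simp add: sum_subtractf algebra_simps)
  also have "\<dots> = (\<Sum>e\<in>edges G. of_int (left_slope (?f e) (len G e)) * \<phi> (Vertex (head G e)))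
      - (\<Sum>e\<in>edges G. of_int (right_slope (?f e) 0) * \<phi> (Vertex (tail G e)))"
    by (simp add: sum_verts_fibre head_verts tail_verts)
  also have "(\<Sum>p\<in>(\<Union>e\<in>edges G. Inner e ` S e). ?o p) = (\<Sum>e\<in>edges G. \<Sum>p\<in>Inner e ` S e. ?o p)"
    using finite_edges S(1) by (intro sum.UNION_disjoint) auto
  also have "\<dots> = (\<Sum>e\<in>edges G. \<Sum>t\<in>S e. of_int (left_slope (?f e) t - right_slope (?f e) t) * \<phi> (Inner e t))"
    by (intro sum.cong refl) (simp add: sum.reindex inj_on_def)
  finally have "wsum \<phi> (div_of G \<psi>) = (\<Sum>e\<in>edges G.
      of_int (left_slope (?f e) (len G e)) * \<phi> (Vertex (head G e))
      - of_int (right_slope (?f e) 0) * \<phi> (Vertex (tail G e))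
      + (\<Sum>t\<in>S e. of_int (left_slope (?f e) t - right_slope (?f e) t) * \<phi> (Inner e t)))"
    by (simp only: sum.distrib sum_subtractf)
  also have "\<dots> = (\<Sum>e\<in>edges G. \<beta> e * (\<psi> (Vertex (head G e)) - \<psi> (Vertex (tail G e)))
    - of_int (right_slope (?f e) 0) * \<tau> e)"
  proof (intro sum.cong refl)
    fix e assume e: "e \<in> edges G"
    have "(\<Sum>t\<in>S e. of_int (left_slope (?f e) t - right_slope (?f e) t) * \<phi> (Inner e t)) =
      (\<Sum>t\<in>S e \<inter> {0<..<len G e}. of_int (left_slope (?f e) t - right_slope (?f e) t) * (\<alpha> e + \<beta> e * t))"
      using S(2)[OF e] e by (intro sum.cong) (auto simp: inner)
    moreover have "?f e (len G e) = \<psi> (Vertex (head G e))" "?f e 0 = \<psi> (Vertex (tail G e))"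
      using len_pos[OF e] by (auto simp: edge_param_def)
    \<comment> \<open>Summation by parts applies to the affine weight; the weight at the tail
      exceeds it by \<open>\<tau> e\<close>, which produces the remaining term.\<close>
    moreover have "of_int (left_slope (?f e) (len G e)) * (\<alpha> e + \<beta> e * len G e) - of_int (right_slope (?f e) 0) * \<alpha> e
      + (\<Sum>t\<in>S e \<inter> {0<..<len G e}. of_int (left_slope (?f e) t - right_slope (?f e) t) * (\<alpha> e + \<beta> e * t)) =
      \<beta> e * (?f e (len G e) - ?f e 0)"
      by (rule slope_summation_by_parts[OF S(1)[OF e] len_pos[OF e]]) (fact S(3)[OF e])
    ultimately show "of_int (left_slope (?f e) (len G e)) * \<phi> (Vertex (head G e))
      - of_int (right_slope (?f e) 0) * \<phi> (Vertex (tail G e))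
      + (\<Sum>t\<in>S e. of_int (left_slope (?f e) t - right_slope (?f e) t) * \<phi> (Inner e t)) =
      \<beta> e * (\<psi> (Vertex (head G e)) - \<psi> (Vertex (tail G e))) - of_int (right_slope (?f e) 0) * \<tau> e"
      unfolding head[OF e] tail[OF e] by (simp add: distrib_left)
  qed
  finally show ?thesis .
qed

end


section \<open>Functions with prescribed bends\<close>

text \<open>Initial slope \<open>k\<close> (for positive bends), decreasing by \<open>c u\<close> at
  each \<open>u\<close>, so that the order at the bend \<open>u\<close> is exactly
  \<open>c u\<close>.\<close>

definition hinge :: "real set \<Rightarrow> (real \<Rightarrow> int) \<Rightarrow> int \<Rightarrow> real \<Rightarrow> real" where
  "hinge U c k t = of_int k * t - (\<Sum>u\<in>U. of_int (c u) * max 0 (t - u))"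

lemma hinge_0 [simp]: "(\<And>u. u \<in> U \<Longrightarrow> 0 < u) \<Longrightarrow> hinge U c k 0 = 0"
  by (auto simp: hinge_def intro!: sum.neutral)

lemma hinge_above:
  assumes "\<And>u. u \<in> U \<Longrightarrow> u \<le> t"
  shows "hinge U c k t = of_int k * t - (\<Sum>u\<in>U. of_int (c u) * (t - u))"
  unfolding hinge_def using assms by (auto intro!: sum.cong)

lemma continuous_on_hinge: "continuous_on A (hinge U c k)"
  unfolding hinge_def by (intro continuous_intros)

lemma hinge_linear:
  assumes "finite U" "{a<..<b} \<inter> U = {}" "s \<in> {a..b}" "t \<in> {a..b}"
  shows "hinge U c k t = hinge U c k s + of_int (k - (\<Sum>u\<in>{u\<in>U. u \<le> a}. c u)) * (t - s)"
proof -
  have "of_int (c u) * max 0 (t - u) - of_int (c u) * max 0 (s - u) =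
      (if u \<le> a then of_int (c u) * (t - s) else 0)" if "u \<in> U" for u
  proof -
    have "u \<notin> {a<..<b}" using that assms(2) by blast
    then have "u \<le> a \<or> b \<le> u" by auto
    then show ?thesis using assms(3,4) by (auto simp: max_def algebra_simps)
  qed
  then have "(\<Sum>u\<in>U. of_int (c u) * max 0 (t - u)) - (\<Sum>u\<in>U. of_int (c u) * max 0 (s - u)) =
      (\<Sum>u\<in>U. if u \<le> a then of_int (c u) * (t - s) else 0)"
    by (simp flip: sum_subtractf)
  also have "\<dots> = (\<Sum>u\<in>{u\<in>U. u \<le> a}. of_int (c u)) * (t - s)"
    using assms(1) by (simp add: sum.inter_filter[symmetric] sum_distrib_right)
  finally show ?thesis by (simp add: hinge_def algebra_simps)
qed

lemma left_slope_hinge: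
  assumes "finite U" and f: "\<And>t. t \<in> {0..L} \<Longrightarrow> f t = C + hinge U c k t" and t: "0 < t" "t \<le> L"
  shows "left_slope f t = k - (\<Sum>u\<in>{u\<in>U. u < t}. c u)"
proof -
  obtain a d where a: "0 \<le> a" "a < t" "t < d" "d \<le> t + 1" "({a<..<d} - {t}) \<inter> U = {}"
    using finite_gap[of U 0 t "t + 1"] assms(1) t by auto
  then have gap: "{a<..<t} \<inter> U = {}" by (auto simp: disjoint_iff)
  have eq: "{u \<in> U. u < t} = {u \<in> U. u \<le> a}"
    using gap a(2) by (auto simp: disjoint_iff) (meson not_le_imp_less)
  show ?thesis
  proof (rule left_slopeI[OF a(2)])
    fix s assume s: "a < s" "s < t"
    have "hinge U c k s = hinge U c k t + of_int (k - (\<Sum>u\<in>{u\<in>U. u \<le> a}. c u)) * (s - t)"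
      using s by (intro hinge_linear[OF assms(1) gap]) auto
    then show "f s = f t + of_int (k - (\<Sum>u\<in>{u\<in>U. u < t}. c u)) * (s - t)"
      unfolding eq using f[of s] f[of t] s a t by simp
  qed
qed

lemma right_slope_hinge:
  assumes "finite U" and f: "\<And>t. t \<in> {0..L} \<Longrightarrow> f t = C + hinge U c k t" and t: "0 \<le> t" "t < L"
  shows "right_slope f t = k - (\<Sum>u\<in>{u\<in>U. u \<le> t}. c u)"
proof -
  obtain a d where a: "t - 1 \<le> a" "a < t" "t < d" "d \<le> L" "({a<..<d} - {t}) \<inter> U = {}"
    using finite_gap[of U "t - 1" t L] assms(1) t by auto
  then have gap: "{t<..<d} \<inter> U = {}" by (auto simp: disjoint_iff)
  show ?thesis
  proof (rule right_slopeI[OF a(3)])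
    fix s assume s: "t < s" "s < d"
    have "hinge U c k s = hinge U c k t + of_int (k - (\<Sum>u\<in>{u\<in>U. u \<le> t}. c u)) * (s - t)"
      using s by (intro hinge_linear[OF assms(1) gap]) auto
    then show "f s = f t + of_int (k - (\<Sum>u\<in>{u\<in>U. u \<le> t}. c u)) * (s - t)"
      using f[of s] f[of t] s a t by simp
  qed
qed

lemma piecewise_linear_int_hinge:
  assumes "finite U" and f: "\<And>t. t \<in> {0..L} \<Longrightarrow> f t = C + hinge U c k t"
  shows "piecewise_linear_int L f"
  unfolding piecewise_linear_int_def linear_int_slope_on_def
proof (intro exI[of _ U] conjI allI impI)
  fix a b assume ab: "0 \<le> a \<and> a \<le> b \<and> b \<le> L \<and> {a<..<b} \<inter> U = {}"
  show "\<exists>k. \<forall>t\<in>{a..b}. f t = f a + of_int k * (t - a)"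
  proof (intro exI ballI)
    fix t assume t: "t \<in> {a..b}"
    have "hinge U c k t = hinge U c k a + of_int (k - (\<Sum>u\<in>{u\<in>U. u \<le> a}. c u)) * (t - a)"
      using t ab by (intro hinge_linear[OF assms(1)]) auto
    then show "f t = f a + of_int (k - (\<Sum>u\<in>{u\<in>U. u \<le> a}. c u)) * (t - a)"
      using f[of t] f[of a] ab t by simp
  qed
qed (rule assms(1))


section \<open>The Abel--Jacobi map of a chain of loops\<close>

lemma UNIV_side: "(UNIV :: side set) = {Top, Bottom}"
  using side.exhaust by auto

locale loop_chain =
  fixes g :: nat and l m :: "nat \<Rightarrow> real"
  assumes lengths_pos: "i \<in> {1..g} \<Longrightarrow> 0 < l i \<and> 0 < m i"
begin

abbreviation "\<Gamma> \<equiv> chain_of_loops g l m"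

definition edge_len :: "nat \<times> side \<Rightarrow> real" where
  "edge_len = (\<lambda>(i, s). case s of Top \<Rightarrow> l i | Bottom \<Rightarrow> m i)"

lemma chain_simps [simp]:
  "verts \<Gamma> = {0..g}" "edges \<Gamma> = {1..g} \<times> UNIV" "tail \<Gamma> (i, s) = i - 1" "head \<Gamma> (i, s) = i"
  "len \<Gamma> = edge_len"
  by (auto simp: chain_of_loops_def edge_len_def)

lemma edge_len_simps [simp]: "edge_len (i, Top) = l i" "edge_len (i, Bottom) = m i"
  by (simp_all add: edge_len_def)

lemma edge_len_pos: "i \<in> {1..g} \<Longrightarrow> 0 < edge_len (i, s)"
  using lengths_pos by (cases s) auto

sublocale finite_metric_graph \<Gamma>
  by unfold_locales (auto simp: lengths_pos UNIV_side)

lemma points_Vertex [simp]: "Vertex v \<in> points \<Gamma> \<longleftrightarrow> v \<le> g"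
  by (auto simp: points_def)

lemma points_Inner [simp]: "Inner e t \<in> points \<Gamma> \<longleftrightarrow> fst e \<in> {1..g} \<and> 0 < t \<and> t < edge_len e"
  by (cases e) (auto simp: points_def)

lemma edge_param_Inner: "0 < t \<Longrightarrow> t < edge_len e \<Longrightarrow> edge_param \<Gamma> e t = Inner e t"
  by (simp add: edge_param_def)

lemma edge_param_ends:
  assumes "i \<in> {1..g}"
  shows "edge_param \<Gamma> (i, s) 0 = Vertex (i - 1)" "edge_param \<Gamma> (i, s) (edge_len (i, s)) = Vertex i"
  using edge_len_pos[OF assms, of s] by (auto simp: edge_param_def)

definition circ :: "nat \<Rightarrow> real" where
  "circ i = l i + m i"

lemma circ_pos: "i \<in> {1..g} \<Longrightarrow> 0 < circ i"
  using lengths_pos[of i] by (simp add: circ_def)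

text \<open>
  The position on the \<open>i\<close>th loop of the retraction of a point to that loop, measured from
  \<open>v\<^sub>i\<close> so that \<open>v\<^sub>i\<^sub>-\<^sub>1\<close> sits at \<open>l i\<close>; it is only meaningful modulo \<open>circ i\<close>.
\<close>

fun angle :: "nat \<Rightarrow> (nat, nat \<times> side) point \<Rightarrow> real" where
  "angle i (Vertex v) = (if v < i then l i else 0)"
| "angle i (Inner (k, s) t) = (if k < i then l i else if k = i then
     (case s of Top \<Rightarrow> l i - t | Bottom \<Rightarrow> t - m i) else 0)"

abbreviation aj :: "nat \<Rightarrow> ((nat, nat \<times> side) point \<Rightarrow>\<^sub>0 int) \<Rightarrow> real" where
  "aj i D \<equiv> wsum (angle i) D"

lemma sum_edges: "(\<Sum>e\<in>{1..g} \<times> UNIV. f e) = (\<Sum>i\<in>{1..g}. f (i, Top) + f (i, Bottom))"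
  by (simp only: UNIV_side sum.cartesian_product') (simp flip: sum.cartesian_product)

text \<open>The angle is affine on every edge, except that along the bottom edge of loop
  \<open>i\<close> it starts at \<open>- m i\<close> instead of \<open>l i\<close>. The height
  differences over the top and bottom edges cancel, and the jump \<open>circ i\<close> times an
  integer slope is left.\<close>

lemma aj_div_of:
  assumes "\<psi> \<in> PL \<Gamma>" "i \<in> {1..g}"
  shows "\<exists>n. aj i (div_of \<Gamma> \<psi>) = of_int n * circ i"
proof -
  let ?\<alpha> = "\<lambda>(k, s). if k < i then l i else if k = i then (case s of Top \<Rightarrow> l i | Bottom \<Rightarrow> - m i) else 0"
  let ?\<beta> = "\<lambda>(k, s). if k = i then (case s of Top \<Rightarrow> - 1 | Bottom \<Rightarrow> 1) else 0"
  let ?\<tau> = "\<lambda>e. if e = (i, Bottom) then circ i else 0"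
  let ?k = "right_slope (\<lambda>t. \<psi> (edge_param \<Gamma> (i, Bottom) t)) 0"
  have "aj i (div_of \<Gamma> \<psi>) = (\<Sum>e\<in>edges \<Gamma>. ?\<beta> e * (\<psi> (Vertex (head \<Gamma> e)) - \<psi> (Vertex (tail \<Gamma> e)))
    - of_int (right_slope (\<lambda>t. \<psi> (edge_param \<Gamma> e t)) 0) * ?\<tau> e)"
    by (rule wsum_div_of[OF assms(1), where \<alpha> = ?\<alpha>])
      (use assms(2) in \<open>auto simp: circ_def split: side.splits if_splits\<close>)
  also have "\<dots> = (\<Sum>k\<in>{1..g}. if k = i then - of_int ?k * circ i else 0)"
    unfolding chain_simps sum_edges by (intro sum.cong) auto
  finally show ?thesis using assms(2) by (auto intro: exI[of _ "- ?k"])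
qed

lemma div_degree_div_of:
  assumes "\<psi> \<in> PL \<Gamma>"
  shows "div_degree (div_of \<Gamma> \<psi>) = 0"
proof -
  have "wsum (\<lambda>_. 1) (div_of \<Gamma> \<psi>) = 0"
    by (subst wsum_div_of[OF assms, where \<alpha> = "\<lambda>_. 1" and \<beta> = "\<lambda>_. 0" and \<tau> = "\<lambda>_. 0"]) auto
  then show ?thesis by (simp flip: div_degree_wsum)
qed

section \<open>Constructing a function with a given divisor\<close>

definition bends :: "((nat, nat \<times> side) point \<Rightarrow>\<^sub>0 int) \<Rightarrow> nat \<times> side \<Rightarrow> real set" where
  "bends B e = {t. Inner e t \<in> Poly_Mapping.keys B}"

lemma finite_bends [simp]: "finite (bends B e)"
  unfolding bends_def by (intro finite_vimageI[unfolded vimage_def]) (auto simp: inj_on_def)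

lemma sum_bends:
  fixes f :: "_ \<Rightarrow> 'a::comm_monoid_add"
  shows "(\<Sum>p\<in>Poly_Mapping.keys B. if p \<in> range (Inner e) then f p else 0) =
    (\<Sum>t\<in>bends B e. f (Inner e t))"
proof -
  have "(\<Sum>p\<in>Poly_Mapping.keys B. if p \<in> range (Inner e) then f p else 0) =
      (\<Sum>p\<in>{p\<in>Poly_Mapping.keys B. p \<in> range (Inner e)}. f p)"
    by (simp add: sum.inter_filter)
  also have "{p\<in>Poly_Mapping.keys B. p \<in> range (Inner e)} = Inner e ` bends B e"
    by (auto simp: bends_def)
  finally show ?thesis by (simp add: sum.reindex inj_on_def)
qed

lemma bends_bounds: "B \<in> Div \<Gamma> \<Longrightarrow> t \<in> bends B e \<Longrightarrow> 0 < t \<and> t < edge_len e \<and> fst e \<in> {1..g}"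
  using points_Inner[of e t] by (fastforce simp: bends_def simp del: points_Inner)

text \<open>For \<open>i > 0\<close>, the part of the chain up to and including
  \<open>Vertex (i - 1)\<close>. It retracts to one point of loop \<open>i\<close>, so
  \<open>angle i\<close> is constant there.\<close>

fun left_of :: "nat \<Rightarrow> (nat, nat \<times> side) point \<Rightarrow> bool" where
  "left_of i (Vertex v) \<longleftrightarrow> v < i"
| "left_of i (Inner e t) \<longleftrightarrow> fst e < i"

definition left_mass :: "((nat, nat \<times> side) point \<Rightarrow>\<^sub>0 int) \<Rightarrow> nat \<Rightarrow> int" where
  "left_mass B i = (\<Sum>p\<in>Poly_Mapping.keys B. if left_of i p then Poly_Mapping.lookup B p else 0)"

abbreviation coeff_on :: "((nat, nat \<times> side) point \<Rightarrow>\<^sub>0 int) \<Rightarrow> nat \<times> side \<Rightarrow> real \<Rightarrow> int" where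
  "coeff_on B e t \<equiv> Poly_Mapping.lookup B (Inner e t)"

lemma left_mass_Suc:
  "left_mass B (Suc i) = left_mass B i + Poly_Mapping.lookup B (Vertex i)
     + (\<Sum>t\<in>bends B (i, Top). coeff_on B (i, Top) t) + (\<Sum>t\<in>bends B (i, Bottom). coeff_on B (i, Bottom) t)"
proof -
  have "left_mass B (Suc i) = (\<Sum>p\<in>Poly_Mapping.keys B. (if left_of i p then Poly_Mapping.lookup B p else 0)
     + (if p = Vertex i then Poly_Mapping.lookup B p else 0)
     + (if p \<in> range (Inner (i, Top)) then Poly_Mapping.lookup B p else 0)
     + (if p \<in> range (Inner (i, Bottom)) then Poly_Mapping.lookup B p else 0))"
    unfolding left_mass_def
  proof (intro sum.cong refl)
    fix p
    show "(if left_of (Suc i) p then Poly_Mapping.lookup B p else 0) =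
     (if left_of i p then Poly_Mapping.lookup B p else 0)
     + (if p = Vertex i then Poly_Mapping.lookup B p else 0)
     + (if p \<in> range (Inner (i, Top)) then Poly_Mapping.lookup B p else 0)
     + (if p \<in> range (Inner (i, Bottom)) then Poly_Mapping.lookup B p else 0)"
    proof (cases p)
      case (Inner e t)
      then show ?thesis by (cases e; cases "snd e") auto
    qed auto
  qed
  then show ?thesis
    by (simp add: sum.distrib sum_bends left_mass_def in_keys_iff)
qed

lemma left_mass_0 [simp]: "left_mass B 0 = 0"
proof -
  have "\<not> left_of 0 p" for p by (cases p) auto
  then show ?thesis by (simp add: left_mass_def)
qed

lemma left_mass_all:
  assumes "B \<in> Div \<Gamma>"
  shows "left_mass B (Suc g) = div_degree B"
  unfolding left_mass_def div_degree_def
proof (intro sum.cong refl)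
  fix p assume "p \<in> Poly_Mapping.keys B"
  then have "p \<in> points \<Gamma>" using assms by auto
  then have "left_of (Suc g) p" by (cases p) auto
  then show "(if left_of (Suc g) p then Poly_Mapping.lookup B p else 0) = Poly_Mapping.lookup B p" by simp
qed

lemma aj_eq:
  "aj i B = l i * of_int (left_mass B i) + (\<Sum>t\<in>bends B (i, Top). of_int (coeff_on B (i, Top) t) * (l i - t))
     + (\<Sum>t\<in>bends B (i, Bottom). of_int (coeff_on B (i, Bottom) t) * (t - m i))"
proof -
  let ?c = "\<lambda>p. of_int (Poly_Mapping.lookup B p) :: real"
  have "aj i B = (\<Sum>p\<in>Poly_Mapping.keys B. l i * (if left_of i p then ?c p else 0)
     + (if p \<in> range (Inner (i, Top)) then ?c p * angle i p else 0)
     + (if p \<in> range (Inner (i, Bottom)) then ?c p * angle i p else 0))"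
    unfolding wsum_def
  proof (intro sum.cong refl)
    fix p
    show "?c p * angle i p = l i * (if left_of i p then ?c p else 0)
     + (if p \<in> range (Inner (i, Top)) then ?c p * angle i p else 0)
     + (if p \<in> range (Inner (i, Bottom)) then ?c p * angle i p else 0)"
    proof (cases p)
      case (Inner e t)
      then show ?thesis by (cases e; cases "snd e") auto
    qed auto
  qed
  also have "\<dots> = l i * (\<Sum>p\<in>Poly_Mapping.keys B. if left_of i p then ?c p else 0)
     + (\<Sum>t\<in>bends B (i, Top). ?c (Inner (i, Top) t) * angle i (Inner (i, Top) t))
     + (\<Sum>t\<in>bends B (i, Bottom). ?c (Inner (i, Bottom) t) * angle i (Inner (i, Bottom) t))"
    by (simp only: sum.distrib sum_bends sum_distrib_left)
  also have "(\<Sum>p\<in>Poly_Mapping.keys B. if left_of i p then ?c p else 0) = of_int (left_mass B i)"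
    by (auto simp: left_mass_def intro!: sum.cong)
  finally show ?thesis by simp
qed

text \<open>Integrate \<open>B\<close> from left to right: balance at the vertices fixes the total
  slope entering each loop, and the coordinate condition says that this slope can be divided between
  top and bottom so that both edges reach the same height.\<close>

lemma principal_exists:
  assumes B: "B \<in> Div \<Gamma>" and deg: "div_degree B = 0"
    and aj: "\<And>i. i \<in> {1..g} \<Longrightarrow> aj i B = of_int (n i) * circ i"
  shows "\<exists>\<psi>\<in>PL \<Gamma>. div_of \<Gamma> \<psi> = B"
proof -
  \<comment> \<open>The two initial slopes add up to \<open>- left_mass B i\<close>, as the balance
    at \<open>Vertex (i - 1)\<close> demands; the winding number \<open>n i\<close> decides how they
    are divided.\<close>
  define k where "k = (\<lambda>(i, s). case s of Top \<Rightarrow> n i - left_mass B i | Bottom \<Rightarrow> - n i)"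
  define F where "F e = hinge (bends B e) (coeff_on B e) (k e)" for e
  define height where "height i = (\<Sum>j=1..i. F (j, Top) (l j))" for i
  define \<psi> where "\<psi> p = (case p of Vertex v \<Rightarrow> height v | Inner e t \<Rightarrow> height (fst e - 1) + F e t)" for p
  note bounds = bends_bounds[OF B]
  \<comment> \<open>The loop closes up: the rises along its two edges differ by
    \<open>of_int (n i) * circ i - aj i B\<close>, which is zero.\<close>
  have F_end: "F (i, s) (edge_len (i, s)) = F (i, Top) (l i)" if i: "i \<in> {1..g}" for i s
  proof (cases s)
    case Bottom
    have T: "F (i, Top) (l i) = of_int (n i - left_mass B i) * l i
        - (\<Sum>t\<in>bends B (i, Top). of_int (coeff_on B (i, Top) t) * (l i - t))"
      unfolding F_def using bounds by (subst hinge_above) (force simp: k_def)+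
    have "F (i, Bottom) (m i) = of_int (- n i) * m i
        - (\<Sum>t\<in>bends B (i, Bottom). of_int (coeff_on B (i, Bottom) t) * (m i - t))"
      unfolding F_def using bounds by (subst hinge_above) (force simp: k_def)+
    also have "(\<Sum>t\<in>bends B (i, Bottom). of_int (coeff_on B (i, Bottom) t) * (m i - t)) =
        - (\<Sum>t\<in>bends B (i, Bottom). of_int (coeff_on B (i, Bottom) t) * (t - m i))"
      by (simp add: algebra_simps flip: sum_negf)
    finally show ?thesis
      using T aj[OF i] unfolding aj_eq circ_def Bottom edge_len_simps
      by (simp add: algebra_simps)
  qed simp
  have \<psi>_edge: "\<psi> (edge_param \<Gamma> (i, s) t) = height (i - 1) + F (i, s) t"
    if i: "i \<in> {1..g}" and t: "t \<in> {0..edge_len (i, s)}" for i s t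
  proof -
    consider "t = 0" | "t = edge_len (i, s)" | "0 < t" "t < edge_len (i, s)" using t by fastforce
    then show ?thesis
    proof cases
      case 1
      then show ?thesis using edge_param_ends[OF i, of s] bounds by (auto simp: \<psi>_def F_def)
    next
      case 2
      have "height i = height (i - 1) + F (i, Top) (l i)"
        using i by (cases i) (auto simp: height_def)
      then show ?thesis using 2 edge_param_ends[OF i, of s] F_end[OF i, of s] by (simp add: \<psi>_def)
    next
      case 3
      then show ?thesis by (simp add: edge_param_Inner \<psi>_def)
    qed
  qed
  have hinge: "\<psi> (edge_param \<Gamma> (i, s) t) =
      height (i - 1) + hinge (bends B (i, s)) (coeff_on B (i, s)) (k (i, s)) t"
    if "i \<in> {1..g}" "t \<in> {0..edge_len (i, s)}" for i s t
    using \<psi>_edge[OF that] by (simp add: F_def)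
  have PL: "\<psi> \<in> PL \<Gamma>"
    unfolding PL_def
  proof (intro CollectI ballI)
    fix e assume "e \<in> edges \<Gamma>"
    then obtain i s where e: "e = (i, s)" and i: "i \<in> {1..g}" by auto
    have "continuous_on {0..edge_len (i, s)} (\<lambda>t. \<psi> (edge_param \<Gamma> (i, s) t))"
      by (subst continuous_on_cong[OF refl hinge[OF i]])
        (auto intro!: continuous_intros continuous_on_hinge)
    then show "continuous_on {0..len \<Gamma> e} (\<lambda>t. \<psi> (edge_param \<Gamma> e t)) \<and>
        piecewise_linear_int (len \<Gamma> e) (\<lambda>t. \<psi> (edge_param \<Gamma> e t))"
      unfolding e chain_simps by (auto intro: piecewise_linear_int_hinge[OF finite_bends hinge[OF i]])
  qed
  have ls: "left_slope (\<lambda>t. \<psi> (edge_param \<Gamma> (i, s) t)) t =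
      k (i, s) - (\<Sum>u\<in>{u\<in>bends B (i, s). u < t}. coeff_on B (i, s) u)"
    if "i \<in> {1..g}" "0 < t" "t \<le> edge_len (i, s)" for i s t
    by (rule left_slope_hinge[OF finite_bends hinge[OF that(1)] that(2,3)])
  have rs: "right_slope (\<lambda>t. \<psi> (edge_param \<Gamma> (i, s) t)) t =
      k (i, s) - (\<Sum>u\<in>{u\<in>bends B (i, s). u \<le> t}. coeff_on B (i, s) u)"
    if "i \<in> {1..g}" "0 \<le> t" "t < edge_len (i, s)" for i s t
    by (rule right_slope_hinge[OF finite_bends hinge[OF that(1)] that(2,3)])
  have ls_end: "left_slope (\<lambda>t. \<psi> (edge_param \<Gamma> (i, s) t)) (edge_len (i, s)) =
      k (i, s) - (\<Sum>u\<in>bends B (i, s). coeff_on B (i, s) u)" if "i \<in> {1..g}" for i s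
  proof -
    have "{u\<in>bends B (i, s). u < edge_len (i, s)} = bends B (i, s)" using bounds by auto
    then show ?thesis using ls[OF that edge_len_pos[OF that]] by simp
  qed
  have rs_0: "right_slope (\<lambda>t. \<psi> (edge_param \<Gamma> (i, s) t)) 0 = k (i, s)" if "i \<in> {1..g}" for i s
  proof -
    have "{u\<in>bends B (i, s). u \<le> 0} = {}" using bounds by force
    then show ?thesis using rs[OF that _ edge_len_pos[OF that], of s] by (simp only: sum.empty)
  qed
  have ord: "ord_at \<Gamma> \<psi> p = Poly_Mapping.lookup B p" if p: "p \<in> points \<Gamma>" for p
  proof (cases p)
    case (Vertex v)
    \<comment> \<open>Both slope sums at \<open>v\<close> contain
      \<open>- left_mass B (Suc v)\<close>, and their difference is the coefficient at
      \<open>v\<close>. No edge ends at vertex \<open>0\<close> and none starts at \<open>g\<close>;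
      the latter case uses degree zero.\<close>
    have "(\<Sum>e\<in>{e\<in>edges \<Gamma>. head \<Gamma> e = v}. left_slope (\<lambda>t. \<psi> (edge_param \<Gamma> e t)) (len \<Gamma> e)) =
        Poly_Mapping.lookup B (Vertex v) - left_mass B (Suc v)"
    proof (cases "v = 0")
      case True
      have "bends B (0, s) = {}" for s using bounds[of _ "(0, s)"] by auto
      moreover have no_edge: "{e\<in>edges \<Gamma>. head \<Gamma> e = v} = {}" using True by auto
      ultimately show ?thesis unfolding no_edge using True left_mass_Suc[of B 0] by simp
    next
      case False
      then have v: "v \<in> {1..g}" using p Vertex by auto
      then have "{e\<in>edges \<Gamma>. head \<Gamma> e = v} = {(v, Top), (v, Bottom)}" by (auto simp: UNIV_side)
      then show ?thesis using left_mass_Suc[of B v] ls_end[OF v, of Top] ls_end[OF v, of Bottom]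
        by (simp add: k_def)
    qed
    moreover have "(\<Sum>e\<in>{e\<in>edges \<Gamma>. tail \<Gamma> e = v}. right_slope (\<lambda>t. \<psi> (edge_param \<Gamma> e t)) 0) =
        - left_mass B (Suc v)"
    proof (cases "v = g")
      case True
      then have no_edge: "{e\<in>edges \<Gamma>. tail \<Gamma> e = v} = {}" by auto
      show ?thesis unfolding no_edge using True left_mass_all[OF B] deg by simp
    next
      case False
      then have v: "Suc v \<in> {1..g}" using p Vertex by auto
      then have "{e\<in>edges \<Gamma>. tail \<Gamma> e = v} = {(Suc v, Top), (Suc v, Bottom)}" by (auto simp: UNIV_side)
      then show ?thesis using rs_0[OF v] by (simp add: k_def)
    qed
    ultimately show ?thesis using Vertex by simp
  next
    case (Inner e t)
    obtain i s where e: "e = (i, s)" by (cases e)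
    with Inner p have t: "i \<in> {1..g}" "0 < t" "t < edge_len (i, s)" by auto
    let ?U = "{u\<in>bends B (i, s). u < t}"
    have "(\<Sum>u\<in>{u\<in>bends B (i, s). u \<le> t}. coeff_on B (i, s) u) = (\<Sum>u\<in>?U. coeff_on B (i, s) u) + coeff_on B (i, s) t"
    proof (cases "t \<in> bends B (i, s)")
      case True
      then have "{u\<in>bends B (i, s). u \<le> t} = insert t ?U" by auto
      then show ?thesis by simp
    next
      case False
      then have "{u\<in>bends B (i, s). u \<le> t} = ?U" by (auto simp: order_le_less)
      then show ?thesis using False by (simp add: bends_def in_keys_iff)
    qed
    then show ?thesis using Inner e ls[of i t s] rs[of i t s] t by simp
  qed
  have "div_of \<Gamma> \<psi> = B"
  proof (rule poly_mapping_eqI)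
    fix p
    show "Poly_Mapping.lookup (div_of \<Gamma> \<psi>) p = Poly_Mapping.lookup B p"
      using ord[of p] lookup_div_of[OF PL, of p] B by (auto simp: in_keys_iff)
  qed
  with PL show ?thesis by blast
qed

text \<open>Abel's theorem for the chain: in each degree the coordinates embed the divisor classes
  into a product of \<open>g\<close> circles. One direction is \<open>aj_div_of\<close>; for the
  other, the coordinate differences supply the integers for \<open>principal_exists\<close>.\<close>

theorem equivalent_iff:
  assumes "D \<in> Div \<Gamma>" "D' \<in> Div \<Gamma>"
  shows "equivalent \<Gamma> D D' \<longleftrightarrow> div_degree D = div_degree D' \<and>
    (\<forall>i\<in>{1..g}. [aj i D = aj i D'] (rmod circ i))"
proof
  assume "equivalent \<Gamma> D D'"
  then obtain \<psi> where \<psi>: "\<psi> \<in> PL \<Gamma>" "D - D' = div_of \<Gamma> \<psi>" by (auto simp: equivalent_def)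
  have "[aj i D = aj i D'] (rmod circ i)" if i: "i \<in> {1..g}" for i
  proof -
    obtain n where "aj i (D - D') = of_int n * circ i" using aj_div_of[OF \<psi>(1) i] \<psi>(2) by auto
    then have "aj i D = aj i D' + of_int n * circ i" by simp
    then show ?thesis by (metis rcong_altdef rcong_sym)
  qed
  moreover have "div_degree D = div_degree D'"
    using div_degree_div_of[OF \<psi>(1)] \<psi>(2) by (metis div_degree_diff eq_iff_diff_eq_0)
  ultimately show "div_degree D = div_degree D' \<and> (\<forall>i\<in>{1..g}. [aj i D = aj i D'] (rmod circ i))" by blast
next
  assume R: "div_degree D = div_degree D' \<and> (\<forall>i\<in>{1..g}. [aj i D = aj i D'] (rmod circ i))"
  have "\<forall>i\<in>{1..g}. \<exists>n. aj i D = aj i D' + of_int n * circ i"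
    using R rcong_altdef rcong_sym by metis
  then obtain n where n: "\<And>i. i \<in> {1..g} \<Longrightarrow> aj i D = aj i D' + of_int (n i) * circ i" by metis
  have "D - D' \<in> Div \<Gamma>" using assms keys_diff[of D D'] by auto
  then obtain \<psi> where "\<psi> \<in> PL \<Gamma>" "div_of \<Gamma> \<psi> = D - D'"
    using principal_exists[of "D - D'" n] R n by auto
  then show "equivalent \<Gamma> D D'" unfolding equivalent_def by metis
qed

end


section \<open>Effective classes and rank on a chain of loops\<close>

context loop_chain
begin

lemma left_of_mono: "left_of i p \<Longrightarrow> i \<le> j \<Longrightarrow> left_of j p"
  by (cases p) auto

lemma angle_left_of: "left_of i p \<Longrightarrow> angle i p = l i"
proof (cases p)
  case (Inner e t)
  then show "left_of i p \<Longrightarrow> angle i p = l i" by (cases e) auto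
qed auto

section \<open>Least degree of an effective divisor with given coordinates\<close>

definition loop_mass :: "((nat, nat \<times> side) point \<Rightarrow>\<^sub>0 int) \<Rightarrow> nat \<Rightarrow> int" where
  "loop_mass E i = (\<Sum>t\<in>bends E (i, Top). coeff_on E (i, Top) t) + (\<Sum>t\<in>bends E (i, Bottom). coeff_on E (i, Bottom) t)"

lemma left_mass_Suc':
  "left_mass E (Suc i) = left_mass E i + Poly_Mapping.lookup E (Vertex i) + loop_mass E i"
  by (simp add: left_mass_Suc loop_mass_def)

lemma loop_mass_nonneg: "effective E \<Longrightarrow> 0 \<le> loop_mass E i"
  by (auto simp: loop_mass_def effective_def intro!: add_nonneg_nonneg sum_nonneg)

lemma left_mass_nonneg: "effective E \<Longrightarrow> 0 \<le> left_mass E i"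
  by (auto simp: left_mass_def effective_def intro!: sum_nonneg)

lemma aj_loop_mass_0:
  assumes "effective E" "loop_mass E i = 0"
  shows "aj i E = l i * of_int (left_mass E i)"
proof -
  have nonneg: "0 \<le> (\<Sum>t\<in>bends E (i, s). coeff_on E (i, s) t)" for s
    using assms(1) by (auto simp: effective_def intro!: sum_nonneg)
  have 0: "(\<Sum>t\<in>bends E (i, s). coeff_on E (i, s) t) = 0" for s
    using assms(2) nonneg[of Top] nonneg[of Bottom] by (cases s) (auto simp: loop_mass_def)
  have "coeff_on E (i, s) t = 0" if "t \<in> bends E (i, s)" for s t
    using 0[of s] that assms(1) by (subst (asm) sum_nonneg_eq_0_iff) (auto simp: effective_def)
  then show ?thesis unfolding aj_eq by simp
qed

text \<open>
  The number of chips strictly left of \<open>v\<^sub>i\<close> in the \<open>v\<^sub>g\<close>-reduced divisor with Abel--Jacobi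
  coordinates \<open>x\<close>: moving to the right, a new chip is required on a loop exactly when the chips
  already collected at its left end do not sum to the right position.
\<close>

primrec need :: "(nat \<Rightarrow> real) \<Rightarrow> nat \<Rightarrow> nat" where
  "need x 0 = 0"
| "need x (Suc i) = need x i +
     (if [x (Suc i) = real (need x i) * l (Suc i)] (rmod circ (Suc i)) then 0 else 1)"

lemma need_cong:
  assumes "\<And>j. j \<in> {1..i} \<Longrightarrow> [x j = y j] (rmod circ j)"
  shows "need x i = need y i"
  using assms
proof (induction i)
  case (Suc i)
  have "[x (Suc i) = y (Suc i)] (rmod circ (Suc i))" using Suc.prems by auto
  then have "[x (Suc i) = c] (rmod circ (Suc i)) \<longleftrightarrow> [y (Suc i) = c] (rmod circ (Suc i))" for c
    using rcong_sym rcong_trans by blast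
  moreover have "need x i = need y i" using Suc by auto
  ultimately show ?case by simp
qed simp

text \<open>The right side counts the chips strictly left of \<open>Vertex i\<close>. If no surplus
  is left after the next loop's own chips are added, then \<open>E\<close> has exactly
  \<open>need x i\<close> chips up to that loop and none inside it; its coordinate then passes the
  test, so \<open>need\<close> does not grow.\<close>

lemma need_le_left_mass:
  assumes "E \<in> Div \<Gamma>" "effective E" "\<And>i. i \<in> {1..g} \<Longrightarrow> [aj i E = x i] (rmod circ i)" "i \<le> g"
  shows "int (need x i) \<le> left_mass E (Suc i) - Poly_Mapping.lookup E (Vertex i)"
  using assms(4)
proof (induction i)
  case 0
  then show ?case using loop_mass_nonneg[OF assms(2), of 0] by (simp add: left_mass_Suc')
next
  case (Suc i)
  then have IH: "int (need x i) \<le> left_mass E (Suc i) - Poly_Mapping.lookup E (Vertex i)" by simp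
  have nonneg: "0 \<le> loop_mass E (Suc i)" "0 \<le> Poly_Mapping.lookup E (Vertex i)"
    using loop_mass_nonneg assms(2) by (auto simp: effective_def)
  show ?case
  proof (cases "int (need x i) < left_mass E (Suc i) + loop_mass E (Suc i)")
    case True
    then show ?thesis by (simp add: left_mass_Suc'[of E "Suc i"])
  next
    case False
    then have eq: "left_mass E (Suc i) = int (need x i)" "loop_mass E (Suc i) = 0"
      using IH nonneg by auto
    have "aj (Suc i) E = real (need x i) * l (Suc i)"
      using aj_loop_mass_0[OF assms(2) eq(2)] eq(1) by simp
    then have "[x (Suc i) = real (need x i) * l (Suc i)] (rmod circ (Suc i))"
      using assms(3)[of "Suc i"] Suc.prems by (simp add: rcong_sym_iff)
    then show ?thesis using eq by (simp add: left_mass_Suc'[of E "Suc i"])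
  qed
qed

lemma need_le_degree:
  assumes "E \<in> Div \<Gamma>" "effective E" "\<And>i. i \<in> {1..g} \<Longrightarrow> [aj i E = x i] (rmod circ i)"
  shows "int (need x g) \<le> div_degree E"
proof -
  have "0 \<le> Poly_Mapping.lookup E (Vertex g)" using assms(2) by (simp add: effective_def)
  then show ?thesis
    using need_le_left_mass[OF assms order_refl] left_mass_all[OF assms(1)] by simp
qed

text \<open>Position \<open>0\<close> is \<open>Vertex i\<close> itself; every other position is
  realized left of \<open>Vertex i\<close> and not left of \<open>Vertex (i - 1)\<close>, hence with
  angle zero on all earlier loops.\<close>

lemma point_with_angle:
  assumes i: "i \<in> {1..g}" and y: "\<not> [y = 0] (rmod circ i)"
  obtains p where "p \<in> points \<Gamma>" "[angle i p = y] (rmod circ i)" "left_of (Suc i) p"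
    "\<And>j. j < i \<Longrightarrow> angle j p = 0"
proof -
  define z where "z = y rmod circ i"
  have z: "0 < z" "z < circ i" "[z = y] (rmod circ i)"
    using y circ_pos[OF i] rmod_nonneg[of "circ i" y] rmod_less[of "circ i" y]
    by (auto simp: z_def rcong_0_iff)
  consider "z < l i" | "z = l i" | "z > l i" by linarith
  then show thesis
  proof cases
    case 1
    then show thesis using that[of "Inner (i, Top) (l i - z)"] z i by auto
  next
    case 2
    then show thesis using that[of "Vertex (i - 1)"] z i by auto
  next
    \<comment> \<open>The bottom edge is parametrized by negative angles, so the point found has
      angle \<open>z - circ i\<close>.\<close>
    case 3
    have "z - l i - m i = z + of_int (- 1) * circ i" by (simp add: circ_def)
    then have "[z = z - l i - m i] (rmod circ i)" using rcong_altdef by metis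
    then have "[z - l i - m i = y] (rmod circ i)" using z(3) rcong_sym rcong_trans by blast
    then show thesis using 3 that[of "Inner (i, Bottom) (z - l i)"] z i by (auto simp: circ_def)
  qed
qed

text \<open>Greedy construction: a chip is added only where \<open>need\<close> grows, at the
  position that corrects the coordinate of this loop and leaves the earlier ones alone.\<close>

lemma effective_need_exists:
  assumes "i \<le> g"
  shows "\<exists>E\<in>Div \<Gamma>. effective E \<and> div_degree E = int (need x i) \<and>
    (\<forall>p\<in>Poly_Mapping.keys E. left_of (Suc i) p) \<and> (\<forall>j\<in>{1..i}. [aj j E = x j] (rmod circ j))"
  using assms
proof (induction i)
  case 0
  then show ?case by (intro bexI[of _ 0]) (auto simp: effective_def div_degree_def)
next
  case (Suc i)
  then obtain E where E: "E \<in> Div \<Gamma>" "effective E" "div_degree E = int (need x i)"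
    "\<And>p. p \<in> Poly_Mapping.keys E \<Longrightarrow> left_of (Suc i) p"
    "\<And>j. j \<in> {1..i} \<Longrightarrow> [aj j E = x j] (rmod circ j)" by auto
  have ajE: "aj (Suc i) E = l (Suc i) * real (need x i)"
    using wsum_const[of E "angle (Suc i)" "l (Suc i)"] E(3,4) angle_left_of by simp
  have i: "Suc i \<in> {1..g}" using Suc.prems by simp
  show ?case
  proof (cases "[x (Suc i) = real (need x i) * l (Suc i)] (rmod circ (Suc i))")
    case True
    have "[aj j E = x j] (rmod circ j)" if "j \<in> {1..Suc i}" for j
      using E(5)[of j] that True ajE by (cases "j = Suc i") (auto simp: rcong_sym_iff mult.commute)
    then show ?thesis using E True left_of_mono[of "Suc i" _ "Suc (Suc i)"] by (intro bexI[of _ E]) auto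
  next
    case False
    have "\<not> [x (Suc i) - real (need x i) * l (Suc i) = 0] (rmod circ (Suc i))"
    proof
      assume "[x (Suc i) - real (need x i) * l (Suc i) = 0] (rmod circ (Suc i))"
      from rcong_add[OF this rcong_refl[of "real (need x i) * l (Suc i)"]] False show False by simp
    qed
    then obtain p where p: "p \<in> points \<Gamma>"
      "[angle (Suc i) p = x (Suc i) - real (need x i) * l (Suc i)] (rmod circ (Suc i))"
      "left_of (Suc (Suc i)) p" "\<And>j. j < Suc i \<Longrightarrow> angle j p = 0"
      using point_with_angle[OF i] by metis
    let ?E = "E + frag_of p"
    have "aj (Suc i) ?E = angle (Suc i) p + l (Suc i) * real (need x i)" using ajE by simp
    moreover have "[angle (Suc i) p + l (Suc i) * real (need x i) = x (Suc i)] (rmod circ (Suc i))"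
      using rcong_add[OF p(2) rcong_refl[of "real (need x i) * l (Suc i)"]] by (simp add: mult.commute)
    ultimately have "[aj j ?E = x j] (rmod circ j)" if "j \<in> {1..Suc i}" for j
      using E(5)[of j] that p(4)[of j] by (cases "j = Suc i") (auto simp: add.commute)
    moreover have keys: "Poly_Mapping.keys ?E \<subseteq> insert p (Poly_Mapping.keys E)"
      using keys_add[of E "frag_of p"] by (auto simp: keys_frag_of)
    moreover have "effective ?E" using E(2) by (auto simp: effective_def lookup_add lookup_frag_of)
    moreover have "div_degree ?E = int (need x (Suc i))" using E(3) False by simp
    ultimately show ?thesis
      using E(1,4) p(1,3) left_of_mono[of "Suc i" _ "Suc (Suc i)"] by (intro bexI[of _ ?E]) auto
  qed
qed

lemma exists_divisor:
  obtains D where "D \<in> Div \<Gamma>" "div_degree D = d" "\<And>i. i \<in> {1..g} \<Longrightarrow> [aj i D = x i] (rmod circ i)"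
    "int (need x g) \<le> d \<Longrightarrow> effective D"
proof -
  obtain E where E: "E \<in> Div \<Gamma>" "effective E" "div_degree E = int (need x g)"
    "\<And>i. i \<in> {1..g} \<Longrightarrow> [aj i E = x i] (rmod circ i)"
    using effective_need_exists[OF order_refl, of x] by auto
  \<comment> \<open>Chips at the last vertex have angle zero on every loop, so they adjust the
    degree without moving the coordinates.\<close>
  let ?c = "d - int (need x g)"
  let ?D = "E + frag_cmul ?c (frag_of (Vertex g))"
  show thesis
  proof (rule that[of ?D])
    show "?D \<in> Div \<Gamma>"
      using keys_add[of E "frag_cmul ?c (frag_of (Vertex g))"] keys_cmul[of ?c "frag_of (Vertex g)"] E(1)
      by (fastforce simp: keys_frag_of)
    show "effective ?D" if "int (need x g) \<le> d"
      using E(2) that by (auto simp: effective_def lookup_add lookup_frag_of)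
    show "[aj i ?D = x i] (rmod circ i)" if "i \<in> {1..g}" for i
      using E(4)[OF that] that by auto
  qed (simp add: E(3))
qed

theorem equiv_to_effective_iff:
  assumes "D \<in> Div \<Gamma>"
  shows "equiv_to_effective \<Gamma> D \<longleftrightarrow> int (need (\<lambda>i. aj i D) g) \<le> div_degree D"
proof
  assume "equiv_to_effective \<Gamma> D"
  then obtain E where "E \<in> Div \<Gamma>" "effective E" "equivalent \<Gamma> D E" by (auto simp: equiv_to_effective_def)
  then show "int (need (\<lambda>i. aj i D) g) \<le> div_degree D"
    using need_le_degree[of E "\<lambda>i. aj i D"] equivalent_iff[OF assms] by (metis rcong_sym)
next
  assume le: "int (need (\<lambda>i. aj i D) g) \<le> div_degree D"
  obtain E where "E \<in> Div \<Gamma>" "div_degree E = div_degree D" "effective E"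
    "\<And>i. i \<in> {1..g} \<Longrightarrow> [aj i E = aj i D] (rmod circ i)"
    using exists_divisor[of "div_degree D" "\<lambda>i. aj i D"] le by metis
  then show "equiv_to_effective \<Gamma> D"
    unfolding equiv_to_effective_def using equivalent_iff[OF assms] by (metis rcong_sym)
qed

section \<open>The worst effective divisor to subtract\<close>

text \<open>
  The maximum of \<open>need (x - aj E) i + j\<close> over the effective divisors \<open>E\<close> of degree \<open>j\<close> that are
  supported at or left of \<open>v\<^sub>i\<close>.  A chip of \<open>E\<close> inside the next loop always forces an additional
  chip there.
\<close>

primrec load :: "(nat \<Rightarrow> real) \<Rightarrow> nat \<Rightarrow> nat \<Rightarrow> nat" where
  "load x 0 = (\<lambda>j. j)"
| "load x (Suc i) = (\<lambda>j. max
     (load x i j + (if [x (Suc i) = real (load x i j) * l (Suc i)] (rmod circ (Suc i)) then 0 else 1))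
     (if j = 0 then 0 else load x i (j - 1) + 2))"

lemma load_strict: "load x i j < load x i (Suc j)"
proof (induction i arbitrary: j)
  case (Suc i)
  have "load x (Suc i) j \<le> load x i j + 1" using Suc.IH[of "j - 1"] by (cases j) auto
  moreover have "load x i j + 2 \<le> load x (Suc i) (Suc j)" by simp
  ultimately show ?case by linarith
qed simp

lemma load_Suc_le: "load x (Suc i) j \<le> load x i j + 1"
  using load_strict[of x i "j - 1"] by (cases j) auto

lemma load_add_le: "load x i j + k \<le> load x i (j + k)"
proof (induction k)
  case (Suc k)
  then show ?case using load_strict[of x i "j + k"] by simp
qed simp

lemma load_strict_mono: "strict_mono (load x i)"
  by (simp add: strict_mono_Suc_iff load_strict)

lemma load_upper: "load x i j \<le> i + j"
proof (induction i)
  case (Suc i)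
  then show ?case using load_Suc_le[of x i j] by linarith
qed simp

text \<open>Induction along the chain: \<open>a\<close> counts the chips of \<open>E\<close> inside
  the new loop and \<open>b\<close> those at its right end. The latter are always covered by the
  strict growth of \<open>load\<close>.\<close>

lemma need_le_load:
  assumes "effective E" "i \<le> g"
  shows "need (\<lambda>k. x k - aj k E) i + nat (left_mass E (Suc i)) \<le> load x i (nat (left_mass E (Suc i)))"
  using assms(2)
proof (induction i)
  case (Suc i)
  let ?need = "need (\<lambda>k. x k - aj k E)"
  define j where "j = nat (left_mass E (Suc i))"
  define a where "a = nat (loop_mass E (Suc i))"
  define b where "b = nat (Poly_Mapping.lookup E (Vertex (Suc i)))"
  have nonneg: "0 \<le> loop_mass E (Suc i)" "0 \<le> Poly_Mapping.lookup E (Vertex (Suc i))"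
    "0 \<le> left_mass E (Suc i)"
    using loop_mass_nonneg left_mass_nonneg assms(1) by (auto simp: effective_def)
  have j': "nat (left_mass E (Suc (Suc i))) = j + a + b"
    unfolding left_mass_Suc'[of E "Suc i"] j_def a_def b_def using nonneg by (simp add: nat_add_distrib)
  have IH: "?need i + j \<le> load x i j" using Suc by (simp add: j_def)
  show ?case unfolding j'
  proof (cases "a = 0")
    case True
    \<comment> \<open>Each of the \<open>j\<close> chips to the left contributes
      \<open>l (Suc i)\<close>, so the test of \<open>need\<close> becomes a test at
      \<open>?need i + j\<close>. If this equals \<open>load x i j\<close>, it is the test of
      \<open>load\<close>; otherwise the slack absorbs a new chip.\<close>
    then have "aj (Suc i) E = l (Suc i) * real j"
      using aj_loop_mass_0[OF assms(1), of "Suc i"] nonneg by (simp add: a_def j_def)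
    then have "x (Suc i) - aj (Suc i) E - real (?need i) * l (Suc i) = x (Suc i) - real (?need i + j) * l (Suc i)"
      by (simp add: algebra_simps)
    then have "[x (Suc i) - aj (Suc i) E = real (?need i) * l (Suc i)] (rmod circ (Suc i)) \<longleftrightarrow>
        [x (Suc i) = real (?need i + j) * l (Suc i)] (rmod circ (Suc i))"
      by (simp only: rcong_conv_diff_rmod_eq_0)
    then have "?need (Suc i) + j \<le> load x (Suc i) j"
      using IH by (cases "?need i + j = load x i j") auto
    then show "?need (Suc i) + (j + a + b) \<le> load x (Suc i) (j + a + b)"
      using True load_add_le[of x "Suc i" j b] by (simp del: load.simps need.simps)
  next
    case False
    \<comment> \<open>The first chip inside the loop costs at most two, itself and one that it
      forces; the other chips are covered by strict growth.\<close>
    have "load x i j + 2 \<le> load x (Suc i) (j + 1)" by simp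
    moreover have "load x (Suc i) (j + 1) + (a - 1 + b) \<le> load x (Suc i) (j + a + b)"
    proof -
      have eq: "j + a + b = j + 1 + (a - 1 + b)" using False by simp
      show ?thesis unfolding eq by (rule load_add_le)
    qed
    moreover have "?need (Suc i) \<le> ?need i + 1" by simp
    ultimately show "?need (Suc i) + (j + a + b) \<le> load x (Suc i) (j + a + b)"
      using IH False by linarith
  qed
qed simp

text \<open>Two distinct candidates closer than the circumference cannot both be congruent to
  \<open>z\<close>.\<close>

lemma top_point_avoiding:
  assumes "i \<in> {1..g}"
  obtains t where "0 < t" "t < l i" "\<not> [t = z] (rmod circ i)"
proof -
  have pos: "0 < l i" "0 < m i" using lengths_pos[OF assms] by auto
  have "\<not> ([l i / 2 = z] (rmod circ i) \<and> [l i / 3 = z] (rmod circ i))"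
  proof
    assume "[l i / 2 = z] (rmod circ i) \<and> [l i / 3 = z] (rmod circ i)"
    then have "[l i / 2 = l i / 3] (rmod circ i)" using rcong_sym rcong_trans by blast
    then have "l i / 2 = l i / 3" by (rule rcong_imp_eq) (use pos in \<open>auto simp: circ_def\<close>)
    then show False using pos by simp
  qed
  then show thesis using that[of "l i / 2"] that[of "l i / 3"] pos by auto
qed

text \<open>The divisor follows the maximum in the recursion of \<open>load\<close>: either it is
  kept, or a chip is added inside the new loop at a place where the test of \<open>need\<close>
  fails.\<close>

lemma load_attained:
  assumes "i \<le> g"
  shows "\<exists>E\<in>Div \<Gamma>. effective E \<and> div_degree E = int j \<and>
    (\<forall>p\<in>Poly_Mapping.keys E. left_of (Suc i) p) \<and> need (\<lambda>k. x k - aj k E) i + j = load x i j"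
  using assms
proof (induction i arbitrary: j)
  case 0
  let ?E = "frag_cmul (int j) (frag_of (Vertex 0))"
  have "Poly_Mapping.keys ?E \<subseteq> {Vertex 0}" using keys_cmul[of "int j" "frag_of (Vertex 0)"] by simp
  then show ?case by (intro bexI[of _ ?E]) (auto simp: effective_def lookup_frag_of)
next
  case (Suc i)
  have i: "Suc i \<in> {1..g}" using Suc.prems by simp
  show ?case
  proof (cases "0 < j \<and> load x (Suc i) j = load x i (j - 1) + 2")
    case False
    then have eq: "load x (Suc i) j = load x i j +
        (if [x (Suc i) = real (load x i j) * l (Suc i)] (rmod circ (Suc i)) then 0 else 1)"
      by (cases "j = 0") (simp, auto simp: max_def)
    obtain E where E: "E \<in> Div \<Gamma>" "effective E" "div_degree E = int j"
      "\<And>p. p \<in> Poly_Mapping.keys E \<Longrightarrow> left_of (Suc i) p" "need (\<lambda>k. x k - aj k E) i + j = load x i j"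
      using Suc.IH[OF Suc_leD[OF Suc.prems], of j] by blast
    let ?n = "need (\<lambda>k. x k - aj k E) i"
    have "aj (Suc i) E = l (Suc i) * real j"
      using wsum_const[of E "angle (Suc i)" "l (Suc i)"] E(3,4) angle_left_of by simp
    then have "x (Suc i) - aj (Suc i) E - real ?n * l (Suc i) = x (Suc i) - real (load x i j) * l (Suc i)"
      unfolding E(5)[symmetric] by (simp add: algebra_simps)
    then have "[x (Suc i) - aj (Suc i) E = real ?n * l (Suc i)] (rmod circ (Suc i)) \<longleftrightarrow>
        [x (Suc i) = real (load x i j) * l (Suc i)] (rmod circ (Suc i))"
      by (simp only: rcong_conv_diff_rmod_eq_0)
    then have "need (\<lambda>k. x k - aj k E) (Suc i) + j = load x (Suc i) j"
      using E(5) unfolding eq by auto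
    then show ?thesis
      using E(1-4) left_of_mono[of "Suc i" _ "Suc (Suc i)"] by (intro bexI[of _ E]) auto
  next
    case True
    then obtain j' where j: "j = Suc j'" by (cases j) auto
    obtain E where E: "E \<in> Div \<Gamma>" "effective E" "div_degree E = int j'"
      "\<And>p. p \<in> Poly_Mapping.keys E \<Longrightarrow> left_of (Suc i) p" "need (\<lambda>k. x k - aj k E) i + j' = load x i j'"
      using Suc.IH[OF Suc_leD[OF Suc.prems], of j'] by blast
    let ?n = "need (\<lambda>k. x k - aj k E) i"
    \<comment> \<open>The new chip has angle \<open>l (Suc i) - t\<close>; the excluded residue is
      the one for which the test of \<open>need\<close> would succeed.\<close>
    obtain t where t: "0 < t" "t < l (Suc i)"
      "\<not> [t = real ?n * l (Suc i) - x (Suc i) + aj (Suc i) E + l (Suc i)] (rmod circ (Suc i))"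
      using top_point_avoiding[OF i] by blast
    let ?p = "Inner (Suc i, Top) t"
    let ?E = "E + frag_of ?p"
    have n: "need (\<lambda>k. x k - aj k ?E) i = ?n" by (rule need_cong) auto
    have "\<not> [x (Suc i) - aj (Suc i) ?E = real ?n * l (Suc i)] (rmod circ (Suc i))"
      using t(3) by (simp add: rcong_conv_diff_rmod_eq_0 algebra_simps)
    then have "need (\<lambda>k. x k - aj k ?E) (Suc i) = ?n + 1" unfolding need.simps n by simp
    then have "need (\<lambda>k. x k - aj k ?E) (Suc i) + j = load x (Suc i) j" using E(5) True j by simp
    moreover have keys: "Poly_Mapping.keys ?E \<subseteq> insert ?p (Poly_Mapping.keys E)"
      using keys_add[of E "frag_of ?p"] by (auto simp: keys_frag_of)
    moreover have "effective ?E" using E(2) by (auto simp: effective_def lookup_add lookup_frag_of)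
    moreover have "div_degree ?E = int j" using E(3) j by simp
    moreover have "?p \<in> points \<Gamma>" using t i by simp
    ultimately show ?thesis
      using E(1,4) left_of_mono[of "Suc i" _ "Suc (Suc i)"] by (intro bexI[of _ ?E]) auto
  qed
qed

text \<open>Subtracting \<open>E\<close> leaves an effective class if and only if
  \<open>need\<close> for the shifted coordinates plus \<open>r\<close> is at most the degree; the
  maximum of this quantity over \<open>E\<close> is \<open>load\<close>.\<close>

theorem rank_ge_iff:
  assumes "D \<in> Div \<Gamma>"
  shows "(\<forall>E\<in>Div \<Gamma>. effective E \<and> div_degree E = int r \<longrightarrow> equiv_to_effective \<Gamma> (D - E)) \<longleftrightarrow>
    int (load (\<lambda>i. aj i D) g r) \<le> div_degree D"
proof -
  let ?x = "\<lambda>i. aj i D"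
  have eff: "equiv_to_effective \<Gamma> (D - E) \<longleftrightarrow> int (need (\<lambda>i. ?x i - aj i E) g + r) \<le> div_degree D"
    if "E \<in> Div \<Gamma>" "div_degree E = int r" for E
  proof -
    have "D - E \<in> Div \<Gamma>" using assms that(1) keys_diff[of D E] by auto
    then show ?thesis using equiv_to_effective_iff[of "D - E"] that(2) by auto
  qed
  have upper: "need (\<lambda>i. ?x i - aj i E) g + r \<le> load ?x g r"
    if "E \<in> Div \<Gamma>" "effective E" "div_degree E = int r" for E
    using need_le_load[OF that(2) order_refl, of ?x] left_mass_all[OF that(1)] that(3) by simp
  obtain E where E: "E \<in> Div \<Gamma>" "effective E" "div_degree E = int r"
    "need (\<lambda>i. ?x i - aj i E) g + r = load ?x g r"
    using load_attained[OF order_refl, of r ?x] by blast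
  show ?thesis
  proof
    assume "\<forall>E\<in>Div \<Gamma>. effective E \<and> div_degree E = int r \<longrightarrow> equiv_to_effective \<Gamma> (D - E)"
    then have "equiv_to_effective \<Gamma> (D - E)" using E(1-3) by blast
    then show "int (load ?x g r) \<le> div_degree D" using eff[OF E(1,3)] unfolding E(4) by blast
  next
    assume le: "int (load ?x g r) \<le> div_degree D"
    show "\<forall>E\<in>Div \<Gamma>. effective E \<and> div_degree E = int r \<longrightarrow> equiv_to_effective \<Gamma> (D - E)"
    proof (intro ballI impI)
      fix E assume E: "E \<in> Div \<Gamma>" "effective E \<and> div_degree E = int r"
      then show "equiv_to_effective \<Gamma> (D - E)" using upper[of E] eff[of E] le by linarith
    qed
  qed
qed

end


section \<open>Ballot words and Abel--Jacobi coordinates\<close>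

context loop_chain
begin

lemma load_0_eq_need: "load x i 0 = need x i"
  by (induction i) auto

text \<open>
  The value of \<^term>\<open>load\<close> after \<open>length w\<close> loops if its \<open>j\<close>th entry stayed constant exactly at
  the letters \<open>j\<close> of \<open>w\<close>.
\<close>

definition word_load :: "nat list \<Rightarrow> nat \<Rightarrow> nat" where
  "word_load w j = j + length w - count_list w j"

text \<open>At each loop the congruence that lets the entry named by the letter stay; it fixes the
  coordinate of that loop.\<close>

fun tracks :: "(nat \<Rightarrow> real) \<Rightarrow> nat list \<Rightarrow> bool" where
  "tracks x [] \<longleftrightarrow> True"
| "tracks x (j # w) \<longleftrightarrow> tracks x w \<and>
     [x (Suc (length w)) = real (word_load w j) * l (Suc (length w))] (rmod circ (Suc (length w)))"

lemma tracks_cong: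
  assumes "\<And>i. i \<in> {1..length w} \<Longrightarrow> [x i = y i] (rmod circ i)" "tracks x w"
  shows "tracks y w"
  using assms
proof (induction w)
  case (Cons j w)
  have "[y (Suc (length w)) = x (Suc (length w))] (rmod circ (Suc (length w)))"
    using Cons.prems(1)[of "Suc (length w)"] by (simp add: rcong_sym_iff)
  moreover have "[x (Suc (length w)) = real (word_load w j) * l (Suc (length w))] (rmod circ (Suc (length w)))"
    using Cons.prems(2) by simp
  ultimately have "[y (Suc (length w)) = real (word_load w j) * l (Suc (length w))] (rmod circ (Suc (length w)))"
    by (rule rcong_trans)
  then show ?case using Cons by auto
qed simp

lemma tracks_exists: "\<exists>x. tracks x w"
proof (induction w)
  case (Cons j w)
  then obtain x where x: "tracks x w" by blast
  let ?y = "x(Suc (length w) := real (word_load w j) * l (Suc (length w)))"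
  have "tracks ?y w" by (rule tracks_cong[OF _ x]) auto
  then have "tracks ?y (j # w)" by simp
  then show ?case by blast
qed simp

lemma tracks_determines:
  assumes "tracks x w" "tracks y w" "i \<in> {1..length w}"
  shows "[x i = y i] (rmod circ i)"
  using assms
proof (induction w)
  case (Cons j w)
  show ?case
  proof (cases "i = Suc (length w)")
    case True
    then have "[x i = real (word_load w j) * l i] (rmod circ i)" "[y i = real (word_load w j) * l i] (rmod circ i)"
      using Cons.prems by auto
    then show ?thesis by (rule rcong_trans[OF _ rcong_sym])
  next
    case False
    then show ?thesis using Cons by auto
  qed
qed simp

end

section \<open>Genericity and the growth of the Young diagram\<close>

locale generic_loop_chain = loop_chain +
  assumes generic: "generic_lengths g l m"
begin

text \<open>For \<open>a < b\<close> and \<open>p = b - a\<close>, the congruence gives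
  \<open>(p - n) * l i = n * m i\<close>. Then \<open>l i / m i\<close> is a ratio of positive
  integers with sum \<open>p \<le> 2 * g - 2\<close>, against genericity.\<close>

lemma distinct_multiples:
  assumes i: "i \<in> {1..g}" and "a \<le> 2 * g - 2" "b \<le> 2 * g - 2"
    and cong: "[real a * l i = real b * l i] (rmod circ i)"
  shows "a = b"
proof -
  have False if ab: "a < b" "b \<le> 2 * g - 2" and cong: "[real a * l i = real b * l i] (rmod circ i)" for a b :: nat
  proof -
    have pos: "0 < l i" "0 < m i" using lengths_pos[OF i] by auto
    obtain n where n: "real b * l i = real a * l i + of_int n * circ i"
      using cong rcong_altdef by blast
    define p where "p = int b - int a"
    have p: "0 < p" "p \<le> 2 * int g - 2" using ab by (auto simp: p_def)
    have eq: "of_int p * l i = of_int n * (l i + m i)" using n by (simp add: p_def circ_def algebra_simps)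
    have "0 < of_int n * (l i + m i)" unfolding eq[symmetric] using p pos by simp
    then have "0 < n" using pos by (simp add: zero_less_mult_iff)
    have eq': "of_int (p - n) * l i = of_int n * m i" using eq by (simp add: algebra_simps)
    have "0 < of_int (p - n) * l i" unfolding eq' using \<open>0 < n\<close> pos by simp
    then have pn: "0 < p - n" using pos by (simp add: zero_less_mult_iff)
    then have "l i / m i = of_int n / of_int (p - n)" using eq' pos by (simp add: field_simps)
    moreover have "n + (p - n) \<le> 2 * int g - 2" using p by simp
    ultimately show False using generic i \<open>0 < n\<close> pn unfolding generic_lengths_def by blast
  qed
  then show ?thesis using assms by (metis linorder_neqE_nat rcong_sym)
qed

text \<open>The entries compared are at most \<open>i + r \<le> 2 * g - 2\<close>; this is where the
  bound in the genericity condition enters.\<close>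

lemma load_distinct:
  assumes "i < g" "r < g" "j \<le> r" "j' \<le> r"
    and "[x (Suc i) = real (load x i j) * l (Suc i)] (rmod circ (Suc i))"
    and "[x (Suc i) = real (load x i j') * l (Suc i)] (rmod circ (Suc i))"
  shows "j = j'"
proof -
  have "load x i j = load x i j'"
  proof (rule distinct_multiples)
    show "[real (load x i j) * l (Suc i) = real (load x i j') * l (Suc i)] (rmod circ (Suc i))"
      using assms(5,6) rcong_sym rcong_trans by blast
  qed (use assms load_upper[of x i j] load_upper[of x i j'] in auto)
  then show ?thesis using strict_mono_eq[OF load_strict_mono] by blast
qed

text \<open>At each letter the congruence and the ballot condition let the named entry stay, and
  genericity makes the other entries up to \<open>r\<close> grow.\<close>

lemma load_tracks:
  assumes "ballot r w" "tracks x w" "length w \<le> g" "r < g" "j \<le> r"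
  shows "load x (length w) j = word_load w j"
  using assms(1,2,3,5)
proof (induction w arbitrary: j)
  case Nil
  then show ?case by (simp add: word_load_def)
next
  case (Cons a w)
  have a: "a \<le> r" and ballot: "0 < a \<Longrightarrow> count_list w a < count_list w (a - 1)" using Cons.prems by auto
  have IH: "load x (length w) i = word_load w i" if "i \<le> r" for i
    using Cons that by simp
  have len: "length w < g" using Cons.prems by simp
  have cong: "[x (Suc (length w)) = real (load x (length w) a) * l (Suc (length w))] (rmod circ (Suc (length w)))"
    using Cons.prems(2) IH[OF a] by simp
  show ?case
  proof (cases "j = a")
    case True
    \<comment> \<open>The two entries differ by
      \<open>1 + count_list w (a - 1) - count_list w a\<close>, so the ballot condition says exactly
      that there is room for entry \<open>a\<close> to stay.\<close>
    have "load x (length w) (a - 1) + 2 \<le> load x (length w) a" if "0 < a"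
      using ballot[OF that] IH[OF a] IH[of "a - 1"] a that
        count_le_length[of w a] count_le_length[of w "a - 1"] by (simp add: word_load_def)
    then have "load x (Suc (length w)) a = load x (length w) a" using cong by auto
    then show ?thesis using True IH[OF a] count_le_length[of w a]
      by (simp add: word_load_def del: load.simps)
  next
    case False
    then have "\<not> [x (Suc (length w)) = real (load x (length w) j) * l (Suc (length w))] (rmod circ (Suc (length w)))"
      using load_distinct[OF len assms(4) a Cons.prems(4) cong] by blast
    then have "load x (Suc (length w)) j = load x (length w) j + 1"
      using load_Suc_le[of x "length w" j] by simp
    then show ?thesis using False IH[OF Cons.prems(4)] count_le_length[of w j]
      by (simp add: word_load_def del: load.simps)
  qed
qed

lemma tracks_unique:
  assumes "length w = length w'" "ballot r w" "ballot r w'" "tracks x w" "tracks x w'" "length w \<le> g" "r < g"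
  shows "w = w'"
  using assms(1-6)
proof (induction w w' rule: list_induct2)
  case (Cons a w b w')
  then have eq: "w = w'" by auto
  have "[x (Suc (length w)) = real (load x (length w) a) * l (Suc (length w))] (rmod circ (Suc (length w)))"
    "[x (Suc (length w)) = real (load x (length w) b) * l (Suc (length w))] (rmod circ (Suc (length w)))"
    using Cons.prems load_tracks[of r w x a] load_tracks[of r w x b] assms(7) unfolding eq by auto
  then have "a = b" using load_distinct[of "length w" r a b x] Cons.prems assms(7) by auto
  then show ?case using eq by simp
qed simp

text \<open>Size of the diagram after \<open>i\<close> loops: row \<open>j\<close> has one box for
  each time entry \<open>j\<close> stayed. By \<open>load_upper\<close> the subtraction never
  truncates.\<close>

definition boxes :: "(nat \<Rightarrow> real) \<Rightarrow> nat \<Rightarrow> nat \<Rightarrow> nat" where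
  "boxes x r i = (\<Sum>j\<le>r. j + i - load x i j)"

lemma boxes_Suc: "boxes x r (Suc i) = boxes x r i + card {j. j \<le> r \<and> load x (Suc i) j = load x i j}"
proof -
  have "boxes x r (Suc i) = (\<Sum>j\<le>r. (j + i - load x i j) + (if load x (Suc i) j = load x i j then 1 else 0))"
    unfolding boxes_def
  proof (intro sum.cong refl)
    fix j
    have "load x i j \<le> load x (Suc i) j" by simp
    then have "load x (Suc i) j = load x i j \<or> load x (Suc i) j = load x i j + 1"
      using load_Suc_le[of x i j] by linarith
    then show "j + Suc i - load x (Suc i) j =
        j + i - load x i j + (if load x (Suc i) j = load x i j then 1 else 0)"
      using load_upper[of x i j] by (elim disjE) (simp_all del: load.simps)
  qed
  also have "\<dots> = boxes x r i + (\<Sum>j\<le>r. if load x (Suc i) j = load x i j then 1 else 0)"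
    by (simp only: sum.distrib boxes_def)
  also have "(\<Sum>j\<le>r. if load x (Suc i) j = load x i j then 1 else 0) =
      card {j. j \<le> r \<and> load x (Suc i) j = load x i j}"
    by (simp add: sum.inter_filter[symmetric] del: load.simps)
  finally show ?thesis .
qed

lemma load_constant:
  assumes "load x (Suc i) j = load x i j"
  shows "[x (Suc i) = real (load x i j) * l (Suc i)] (rmod circ (Suc i))"
    and "0 < j \<Longrightarrow> load x i (j - 1) + 2 \<le> load x i j"
  using assms by (auto split: if_splits simp: max_def)

lemma boxes_Suc_le:
  assumes "i < g" "r < g"
  shows "boxes x r (Suc i) \<le> boxes x r i + 1"
proof -
  have "j = j'" if "j \<le> r" "load x (Suc i) j = load x i j" "j' \<le> r" "load x (Suc i) j' = load x i j'" for j j'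
    by (rule load_distinct[OF assms that(1,3) load_constant(1)[OF that(2)] load_constant(1)[OF that(4)]])
  then have "card {j. j \<le> r \<and> load x (Suc i) j = load x i j} \<le> 1"
    by (auto simp: card_le_Suc0_iff_eq simp del: load.simps)
  then show ?thesis by (simp add: boxes_Suc)
qed

lemma boxes_le:
  assumes "g = 0 \<or> r < g" "i \<le> k" "k \<le> g"
  shows "boxes x r k \<le> boxes x r i + (k - i)"
  using assms(2,3)
proof (induction k rule: dec_induct)
  case (step k)
  then show ?case using boxes_Suc_le[of k r x] assms(1) by auto
qed simp

lemma boxes_0 [simp]: "boxes x r 0 = 0"
  by (simp add: boxes_def)

text \<open>Strict growth of \<open>load\<close> makes the row lengths weakly decreasing, so a lower
  bound for the last row holds for every row.\<close>

lemma load_last_imp_row: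
  assumes "load x g r + s \<le> g + r" "j \<le> r"
  shows "s \<le> j + g - load x g j"
  using load_add_le[of x g j "r - j"] assms by simp

lemma load_last_imp_boxes:
  assumes "load x g r + s \<le> g + r"
  shows "(r + 1) * s \<le> boxes x r g"
proof -
  have "(\<Sum>j\<le>r. s) \<le> boxes x r g"
    unfolding boxes_def by (intro sum_mono load_last_imp_row[OF assms]) auto
  then show ?thesis by simp
qed

text \<open>At most one box is added per loop, so reaching \<open>g\<close> boxes after
  \<open>g\<close> loops means exactly one at each; the rows that receive them spell the
  word.\<close>

lemma tracks_exists_word:
  assumes "r < g" "boxes x r g = g" "i \<le> g"
  shows "\<exists>w. length w = i \<and> ballot r w \<and> tracks x w"
  using assms(3)
proof (induction i)
  case (Suc i)
  then obtain w where w: "length w = i" "ballot r w" "tracks x w" by auto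
  have full: "boxes x r k = k" if "k \<le> g" for k
    using boxes_le[of r 0 k x] boxes_le[of r k g x] assms that by simp
  have "card {j. j \<le> r \<and> load x (Suc i) j = load x i j} = 1"
    using boxes_Suc[of x r i] full[of i] full[of "Suc i"] Suc.prems by linarith
  then obtain j where "{j. j \<le> r \<and> load x (Suc i) j = load x i j} = {j}" by (rule card_1_singletonE)
  then have j: "j \<le> r" "load x (Suc i) j = load x i j" by blast+
  have load: "load x i k = word_load w k" if "k \<le> r" for k
    using load_tracks[OF w(2,3) _ assms(1) that] w(1) Suc.prems by simp
  have "count_list w j < count_list w (j - 1)" if "0 < j"
    using load_constant(2)[OF j(2) that] load[OF j(1)] load[of "j - 1"] j(1) that
      count_le_length[of w j] count_le_length[of w "j - 1"]
    by (simp add: word_load_def)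
  then have "length (j # w) = Suc i \<and> ballot r (j # w) \<and> tracks x (j # w)"
    using w j(1) load_constant(1)[OF j(2)] load[OF j(1)] by simp
  then show ?case by blast
qed (auto intro: exI[of _ "[]"])

theorem load_le_iff_tracks:
  assumes "g = (r + 1) * s"
  shows "load x g r + s \<le> g + r \<longleftrightarrow> (\<exists>w\<in>ballot_words r (\<lambda>_. s). tracks x w)"
\<comment> \<open>Here \<open>r < g\<close>, on which \<open>load_distinct\<close> relies, fails;
  but then \<open>s = 0\<close> and only the empty word occurs.\<close>
proof (cases "g = 0")
  case True
  then have "s = 0" using assms by simp
  moreover have "[] \<in> ballot_words r (\<lambda>_. 0)" by (simp add: ballot_words_def)
  ultimately show ?thesis using True by force
next
  case False
  then have "0 < s" using assms by (cases s) auto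
  then have r: "r < g" using assms by (cases s) auto
  show ?thesis
  proof
    assume le: "load x g r + s \<le> g + r"
    have "boxes x r g = g"
      using load_last_imp_boxes[OF le] boxes_le[of r 0 g x] r assms by simp
    then obtain w where w: "length w = g" "ballot r w" "tracks x w"
      using tracks_exists_word[OF r] by blast
    have "count_list w j = s" if "j \<le> r" for j
    proof -
      have ge: "s \<le> count_list w i" if "i \<le> r" for i
        using load_last_imp_row[OF le that] load_tracks[OF w(2,3) _ r that] w(1) count_le_length[of w i]
        by (simp add: word_load_def)
      \<comment> \<open>Every row has at least \<open>s\<close> boxes and the total is
        \<open>(r + 1) * s\<close>, so every row has exactly \<open>s\<close>.\<close>
      have "(\<Sum>i\<le>r. count_list w i) = (\<Sum>i\<le>r. s)"
        using ballot_length[OF w(2)] w(1) assms by simp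
      then show ?thesis using sum_mono_inv[of "\<lambda>_. s" "{..r}" "count_list w" j] ge that by auto
    qed
    then show "\<exists>w\<in>ballot_words r (\<lambda>_. s). tracks x w" using w by (auto simp: ballot_words_def)
  next
    assume "\<exists>w\<in>ballot_words r (\<lambda>_. s). tracks x w"
    then obtain w where w: "ballot r w" "\<And>j. j \<le> r \<Longrightarrow> count_list w j = s" "tracks x w"
      by (auto simp: ballot_words_def)
    have "length w = g" using ballot_length[OF w(1)] w(2) assms by simp
    then show "load x g r + s \<le> g + r"
      using load_tracks[OF w(1,3) _ r order_refl] w(2)[of r] assms by (simp add: word_load_def)
  qed
qed

section \<open>Classes of rank \<open>r\<close> and ballot words\<close>

theorem rank_eq_iff:
  assumes D: "D \<in> Div \<Gamma>" and g: "g = (r + 1) * s" and deg: "div_degree D = int g + int r - int s"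
  shows "rank_of \<Gamma> D = int r \<longleftrightarrow> (\<exists>w\<in>ballot_words r (\<lambda>_. s). tracks (\<lambda>i. aj i D) w)"
proof -
  let ?x = "\<lambda>i. aj i D"
  let ?P = "\<lambda>k. \<forall>E\<in>Div \<Gamma>. effective E \<and> div_degree E = int k \<longrightarrow> equiv_to_effective \<Gamma> (D - E)"
  have P: "?P k \<longleftrightarrow> int (load ?x g k) \<le> div_degree D" for k by (rule rank_ge_iff[OF D])
  have small: "g = 0 \<or> r < g" using g by (cases s) auto
  have eff: "equiv_to_effective \<Gamma> D \<longleftrightarrow> ?P 0"
    unfolding P load_0_eq_need by (rule equiv_to_effective_iff[OF D])
  have "rank_of \<Gamma> D = int r \<longleftrightarrow> ?P r"
  proof
    assume rank: "rank_of \<Gamma> D = int r"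
    then have "?P 0" and greatest: "(GREATEST k. ?P k) = r"
      unfolding rank_of_def eff by (auto split: if_splits)
    \<comment> \<open>This bound ensures that \<open>GREATEST\<close> is attained.\<close>
    moreover have "k \<le> nat (div_degree D)" if "?P k" for k
      using that load_add_le[of ?x g 0 k] unfolding P by simp
    ultimately have "?P (GREATEST k. ?P k)" by (intro GreatestI_nat[of ?P 0]) auto
    then show "?P r" unfolding greatest .
  next
    assume r: "?P r"
    \<comment> \<open>A larger rank would force \<open>s + 1\<close> boxes in each of
      \<open>r + 1\<close> rows, more than \<open>g\<close> loops can supply.\<close>
    have "k \<le> r" if "?P k" for k
    proof (rule ccontr)
      assume "\<not> k \<le> r"
      then have "load ?x g r + (s + 1) \<le> g + r"
        using that load_add_le[of ?x g r "k - r"] deg unfolding P by simp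
      from load_last_imp_boxes[OF this] boxes_le[OF small, of 0 g ?x] g show False by simp
    qed
    then have "(GREATEST k. ?P k) = r" using r by (intro Greatest_equality)
    moreover have "?P 0" using r load_add_le[of ?x g 0 r] strict_mono_less_eq[OF load_strict_mono, of ?x g 0 r]
      unfolding P by simp
    ultimately show "rank_of \<Gamma> D = int r" unfolding rank_of_def eff by presburger
  qed
  also have "\<dots> \<longleftrightarrow> load ?x g r + s \<le> g + r" unfolding P deg by linarith
  finally show ?thesis using load_le_iff_tracks[OF g] by simp
qed

text \<open>A word is sent to the class of degree \<open>d\<close> whose coordinates it prescribes
  through \<open>tracks\<close>; the rank criterion shows that these are all the classes.\<close>

theorem bij_betw_ballot_words_classes:
  assumes g: "g = (r + 1) * s" and d: "d = int g + int r - int s"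
  shows "\<exists>f. bij_betw f (ballot_words r (\<lambda>_. s))
    {C \<in> divisor_classes \<Gamma>. \<exists>D\<in>C. div_degree D = d \<and> rank_of \<Gamma> D = int r}"
proof -
  let ?W = "ballot_words r (\<lambda>_. s)"
  let ?X = "{C \<in> divisor_classes \<Gamma>. \<exists>D\<in>C. div_degree D = d \<and> rank_of \<Gamma> D = int r}"
  define R where "R = {(D, D'). D \<in> Div \<Gamma> \<and> D' \<in> Div \<Gamma> \<and> equivalent \<Gamma> D D'}"
  have R: "(D, D') \<in> R \<longleftrightarrow> D \<in> Div \<Gamma> \<and> D' \<in> Div \<Gamma> \<and> div_degree D = div_degree D' \<and>
      (\<forall>i\<in>{1..g}. [aj i D = aj i D'] (rmod circ i))" for D D'
    using equivalent_iff[of D D'] unfolding R_def by blast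
  have equiv: "equiv (Div \<Gamma>) R"
  proof (rule equivI)
    show "R \<subseteq> Div \<Gamma> \<times> Div \<Gamma>" by (auto simp: R_def)
    show "refl_on (Div \<Gamma>) R" by (rule refl_onI) (simp add: R del: carrier_free_Abelian_group_iff)
    show "sym R" by (rule symI) (metis R rcong_sym)
    show "trans R"
    proof (rule transI)
      fix A B C assume AB: "(A, B) \<in> R" and BC: "(B, C) \<in> R"
      have "[aj i A = aj i C] (rmod circ i)" if "i \<in> {1..g}" for i
        using AB BC that unfolding R by (meson rcong_trans)
      then show "(A, C) \<in> R" using AB BC unfolding R by presburger
    qed
  qed
  have len: "length w = g" if "w \<in> ?W" for w
    using that ballot_length[of r w] g by (auto simp: ballot_words_def)
  have "\<exists>D\<in>Div \<Gamma>. div_degree D = d \<and> tracks (\<lambda>i. aj i D) w" if w: "w \<in> ?W" for w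
  proof -
    obtain x where x: "tracks x w" using tracks_exists by blast
    obtain D where "D \<in> Div \<Gamma>" "div_degree D = d" "\<And>i. i \<in> {1..g} \<Longrightarrow> [aj i D = x i] (rmod circ i)"
      using exists_divisor[of d x] by metis
    then show ?thesis using tracks_cong[OF _ x, of "\<lambda>i. aj i D"] len[OF w] rcong_sym by blast
  qed
  then obtain D where D: "\<And>w. w \<in> ?W \<Longrightarrow> D w \<in> Div \<Gamma>" "\<And>w. w \<in> ?W \<Longrightarrow> div_degree (D w) = d"
    "\<And>w. w \<in> ?W \<Longrightarrow> tracks (\<lambda>i. aj i (D w)) w"
    by metis
  have "inj_on (\<lambda>w. R `` {D w}) ?W"
  proof (rule inj_onI)
    fix w w' assume w: "w \<in> ?W" "w' \<in> ?W" and "R `` {D w} = R `` {D w'}"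
    then have "(D w, D w') \<in> R" using eq_equiv_class[OF _ equiv] D(1) by blast
    \<comment> \<open>Congruent coordinates track the same words, so \<open>D w'\<close> tracks both
      \<open>w\<close> and \<open>w'\<close>, which therefore coincide.\<close>
    then have tracks: "tracks (\<lambda>i. aj i (D w')) w"
      using tracks_cong[OF _ D(3)[OF w(1)]] len[OF w(1)] by (simp add: R)
    show "w = w'"
    proof (cases "g = 0")
      case False
      then have "r < g" using g by (cases s) auto
      then show ?thesis
        using tracks_unique[OF _ _ _ tracks D(3)[OF w(2)]] w len by (auto simp: ballot_words_def)
    qed (use len w in auto)
  qed
  moreover have "(\<lambda>w. R `` {D w}) ` ?W = ?X"
  proof (intro equalityI subsetI)
    fix C assume "C \<in> (\<lambda>w. R `` {D w}) ` ?W"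
    then obtain w where w: "w \<in> ?W" "C = R `` {D w}" by blast
    have "rank_of \<Gamma> (D w) = int r"
      using rank_eq_iff[OF D(1)[OF w(1)] g] D(2,3) w(1) d by auto
    moreover have "D w \<in> C" using w D(1)[OF w(1)] equiv equiv_class_self by metis
    moreover have "C \<in> divisor_classes \<Gamma>"
      unfolding divisor_classes_def w(2) R_def[symmetric] using D(1)[OF w(1)] by (rule quotientI)
    ultimately show "C \<in> ?X" using D(2)[OF w(1)] by blast
  next
    fix C assume "C \<in> ?X"
    then obtain A where C: "C \<in> Div \<Gamma> // R" and A: "A \<in> C" "div_degree A = d" "rank_of \<Gamma> A = int r"
      by (auto simp: divisor_classes_def R_def)
    from C obtain B where B: "C = R `` {B}" by (rule quotientE)
    then have BA: "(B, A) \<in> R" using A(1) by simp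
    then have ADiv: "A \<in> Div \<Gamma>" by (simp add: R_def)
    have CA: "C = R `` {A}" unfolding B by (rule equiv_class_eq[OF equiv BA])
    obtain w where w: "w \<in> ?W" "tracks (\<lambda>i. aj i A) w"
      using rank_eq_iff[OF ADiv g] A d by auto
    \<comment> \<open>Tracking a common word determines every coordinate modulo
      \<open>circ i\<close>, hence the class in degree \<open>d\<close>.\<close>
    have "(A, D w) \<in> R"
      using ADiv D(1,2)[OF w(1)] A(2) tracks_determines[OF w(2) D(3)[OF w(1)]] len[OF w(1)]
      by (simp add: R del: carrier_free_Abelian_group_iff)
    then have "C = R `` {D w}" unfolding CA by (rule equiv_class_eq[OF equiv])
    then show "C \<in> (\<lambda>w. R `` {D w}) ` ?W" using w(1) by blast
  qed
  ultimately show ?thesis unfolding bij_betw_def by blast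
qed

end

theorem theorem1p4:
  fixes g r :: nat and d :: int and l m :: "nat \<Rightarrow> real"
  assumes pos: "\<And>i. i \<in> {1..g} \<Longrightarrow> 0 < l i \<and> 0 < m i"
    and generic: "generic_lengths g l m"
    and rho: "int g - (int r + 1) * (int g - d + int r) = 0"
  defines "X \<equiv> {C \<in> divisor_classes (chain_of_loops g l m).
                  \<exists>D\<in>C. div_degree D = d \<and> rank_of (chain_of_loops g l m) D = int r}"
  shows "finite X \<and>
         real (card X) =
           fact g * (\<Prod>i=0..r. fact i / fact (nat (int g - d + int r + int i)))"
proof -
  interpret generic_loop_chain g l m
    using pos generic by unfold_locales auto
  define s where "s = nat (int g - d + int r)"
  \<comment> \<open>By \<open>rho\<close> this product is \<open>g\<close>, so
    \<open>g - d + r\<close> is nonnegative and its conversion to the natural number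
    \<open>s\<close> is faithful.\<close>
  have "0 \<le> (int r + 1) * (int g - d + int r)" using rho by simp
  then have "0 \<le> int g - d + int r" by (simp add: zero_le_mult_iff)
  then have s: "int s = int g - d + int r" by (simp add: s_def)
  have "int g = int ((r + 1) * s)" using rho unfolding s[symmetric] by (simp add: algebra_simps)
  then have g: "g = (r + 1) * s" by (simp only: of_nat_eq_iff)
  have "d = int g + int r - int s" using s by simp
  then obtain f where f: "bij_betw f (ballot_words r (\<lambda>_. s)) X"
    using bij_betw_ballot_words_classes[OF g] unfolding X_def by blast
  have "nat (int g - d + int r + int i) = s + i" for i using s by simp
  then show ?thesis
    using bij_betw_finite[OF f] bij_betw_same_card[OF f] finite_ballot_words[of r "\<lambda>_. s"]
      card_ballot_words_rectangle[of r s] g by simp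
qed

end
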